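(* Every locally finite connected graph with linear growth and countably infinite automorphism group has exactly $2$ ends.
   Context: Ends: rays are one-way infinite paths; two rays are in the same end if for every finite vertex set $S$ they have tails in the same component of $G-S$; ends are the equivalence classes. For a vertex $v$, $B_v(n)$ denotes the set of vertices at distance at most $n$ from $v$. A connected locally finite graph has linear growth if there is a constant $c$ such that $|B_v(n)|\le cn$ for all $n=1,2,\ldots$ (this property does not depend on the choice of $v$). *)

theory Defs
  imports Complex_Main "HOL-Library.Countable_Set" "HOL-Algebra.Bij"
begin

text \<open>
  Graphs are simple and undirected: a vertex set \<open>V\<close>, finite or infinite, together with a
  symmetric, irreflexive adjacency relation \<open>E\<close> on \<open>V\<close>.
\<close>

definition simple_graph :: "'a set \<Rightarrow> ('a \<times> 'a) set \<Rightarrow> bool" where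
  "simple_graph V E \<longleftrightarrow> E \<subseteq> V \<times> V \<and> sym E \<and> irrefl E"

definition locally_finite :: "'a set \<Rightarrow> ('a \<times> 'a) set \<Rightarrow> bool" where
  "locally_finite V E \<longleftrightarrow> (\<forall>v\<in>V. finite (E `` {v}))"

definition connected_graph :: "'a set \<Rightarrow> ('a \<times> 'a) set \<Rightarrow> bool" where
  "connected_graph V E \<longleftrightarrow> V \<noteq> {} \<and> (\<forall>u\<in>V. \<forall>v\<in>V. (u, v) \<in> E\<^sup>*)"

text \<open>
  A pair belongs to \<open>E ^^ n\<close> iff it is joined by a walk with \<open>n\<close> edges.  The distance is a
  junk value for vertices in different components, which is why the ball asks for reachability.
\<close>

definition graph_dist :: "('a \<times> 'a) set \<Rightarrow> 'a \<Rightarrow> 'a \<Rightarrow> nat" where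
  "graph_dist E u v = (LEAST n. (u, v) \<in> E ^^ n)"

definition graph_ball :: "'a set \<Rightarrow> ('a \<times> 'a) set \<Rightarrow> 'a \<Rightarrow> nat \<Rightarrow> 'a set" where
  "graph_ball V E v n = {u \<in> V. (v, u) \<in> E\<^sup>* \<and> graph_dist E v u \<le> n}"

text \<open>
  Only meaningful for connected locally finite graphs: there all balls are finite (so \<open>card\<close> is
  the true cardinality) and the choice of the centre is irrelevant; see \<open>finite_graph_ball\<close> and
  \<open>linear_growth_iff\<close> below.
\<close>

definition linear_growth :: "'a set \<Rightarrow> ('a \<times> 'a) set \<Rightarrow> bool" where
  "linear_growth V E \<longleftrightarrow>
     (\<exists>v\<in>V. \<exists>c::real. \<forall>n\<ge>1. real (card (graph_ball V E v n)) \<le> c * real n)"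

text \<open>
  Automorphisms are elements of \<open>Bij V\<close>, hence \<open>undefined\<close> outside \<open>V\<close>, so that distinct
  elements of the carrier differ on \<open>V\<close>.
\<close>

definition aut_group :: "'a set \<Rightarrow> ('a \<times> 'a) set \<Rightarrow> ('a \<Rightarrow> 'a) monoid" where
  "aut_group V E = BijGroup V
     \<lparr>carrier := {f \<in> Bij V. \<forall>u\<in>V. \<forall>v\<in>V. (f u, f v) \<in> E \<longleftrightarrow> (u, v) \<in> E}\<rparr>"

definition graph_components :: "'a set \<Rightarrow> ('a \<times> 'a) set \<Rightarrow> 'a set set" where
  "graph_components V E = V // {(u, v) \<in> V \<times> V. (u, v) \<in> E\<^sup>*}"

definition rays :: "'a set \<Rightarrow> ('a \<times> 'a) set \<Rightarrow> (nat \<Rightarrow> 'a) set" where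
  "rays V E = {r. range r \<subseteq> V \<and> inj r \<and> (\<forall>i. (r i, r (Suc i)) \<in> E)}"

text \<open>The graph \<open>G - S\<close> has vertex set \<open>V - S\<close> and adjacency relation \<open>Restr E (V - S)\<close>.\<close>

definition end_rel :: "'a set \<Rightarrow> ('a \<times> 'a) set \<Rightarrow> ((nat \<Rightarrow> 'a) \<times> (nat \<Rightarrow> 'a)) set" where
  "end_rel V E = {(r, s) \<in> rays V E \<times> rays V E.
     \<forall>S. S \<subseteq> V \<and> finite S \<longrightarrow>
       (\<exists>C \<in> graph_components (V - S) (Restr E (V - S)).
          \<exists>m n. r ` {m..} \<subseteq> C \<and> s ` {n..} \<subseteq> C)}"

definition graph_ends :: "'a set \<Rightarrow> ('a \<times> 'a) set \<Rightarrow> (nat \<Rightarrow> 'a) set set" where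
  "graph_ends V E = rays V E // end_rel V E"


lemma graph_ball_eq:
  assumes "simple_graph V E" "v \<in> V"
  shows "graph_ball V E v n = {u. \<exists>k\<le>n. (v, u) \<in> E ^^ k}"
proof -
  have V: "u \<in> V" if "(v, u) \<in> E\<^sup>*" for u
    using that assms by (induction rule: rtrancl_induct) (auto simp: simple_graph_def)
  show ?thesis
  proof (intro Set.set_eqI iffI)
    fix u assume "u \<in> graph_ball V E v n"
    then show "u \<in> {u. \<exists>k\<le>n. (v, u) \<in> E ^^ k}"
      unfolding graph_ball_def graph_dist_def by (auto dest!: rtrancl_imp_relpow intro: LeastI)
  next
    fix u assume "u \<in> {u. \<exists>k\<le>n. (v, u) \<in> E ^^ k}"
    then obtain k where k: "k \<le> n" "(v, u) \<in> E ^^ k" by auto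
    then have "(v, u) \<in> E\<^sup>*" "graph_dist E v u \<le> k"
      by (auto simp: graph_dist_def intro: relpow_imp_rtrancl Least_le)
    with k V show "u \<in> graph_ball V E v n" by (auto simp: graph_ball_def)
  qed
qed

lemma finite_graph_ball:
  assumes "simple_graph V E" "locally_finite V E" "v \<in> V"
  shows "finite (graph_ball V E v n)"
proof -
  have sphere: "finite ((E ^^ k) `` {v}) \<and> (E ^^ k) `` {v} \<subseteq> V" for k
  proof (induction k)
    case (Suc k)
    have "(E ^^ Suc k) `` {v} = (\<Union>w \<in> (E ^^ k) `` {v}. E `` {w})" by auto
    moreover have "finite (\<Union>w \<in> (E ^^ k) `` {v}. E `` {w})"
      using Suc assms(2) unfolding locally_finite_def by blast
    ultimately show ?case using assms(1) by (auto simp: simple_graph_def)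
  qed (use assms in auto)
  have "graph_ball V E v n = (\<Union>k\<le>n. (E ^^ k) `` {v})"
    unfolding graph_ball_eq[OF assms(1,3)] by auto
  then show ?thesis using sphere by auto
qed

lemma linear_growth_iff:
  assumes "simple_graph V E" "locally_finite V E" "connected_graph V E" "w \<in> V"
  shows "linear_growth V E \<longleftrightarrow>
    (\<exists>c::real. \<forall>n\<ge>1. real (card (graph_ball V E w n)) \<le> c * real n)"
proof
  assume "linear_growth V E"
  then obtain v c where v: "v \<in> V"
    and c: "\<And>n. n \<ge> 1 \<Longrightarrow> real (card (graph_ball V E v n)) \<le> c * real n"
    unfolding linear_growth_def by auto
  have "c \<ge> 0" using c[of 1] by (simp add: order_trans[OF of_nat_0_le_iff])
  obtain d where d: "(v, w) \<in> E ^^ d"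
    using assms v unfolding connected_graph_def by (meson rtrancl_imp_relpow)
  have "real (card (graph_ball V E w n)) \<le> c * (1 + real d) * real n" if "n \<ge> 1" for n
  proof -
    have "graph_ball V E w n \<subseteq> graph_ball V E v (d + n)"
      unfolding graph_ball_eq[OF assms(1,4)] graph_ball_eq[OF assms(1) v]
    proof clarify
      fix x k assume "k \<le> n" "(w, x) \<in> E ^^ k"
      with d have "(v, x) \<in> E ^^ (d + k)" unfolding relpow_add by blast
      with \<open>k \<le> n\<close> show "\<exists>k\<le>d + n. (v, x) \<in> E ^^ k" by (auto intro!: exI[of _ "d + k"] simp del: relpow_add)
    qed
    then have "real (card (graph_ball V E w n)) \<le> real (card (graph_ball V E v (d + n)))"
      using finite_graph_ball[OF assms(1,2) v] by (simp add: card_mono)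
    also have "\<dots> \<le> c * real (d + n)" using c[of "d + n"] that by simp
    also have "\<dots> \<le> c * ((1 + real d) * real n)"
      using \<open>c \<ge> 0\<close> that mult_left_mono[of 1 "real n" "real d"]
      by (intro mult_left_mono) (auto simp: algebra_simps)
    finally show ?thesis by (simp add: mult.assoc)
  qed
  then show "\<exists>c::real. \<forall>n\<ge>1. real (card (graph_ball V E w n)) \<le> c * real n" by blast
qed (use assms(4) in \<open>auto simp: linear_growth_def\<close>)

lemma group_aut_group: "group (aut_group V E)"
proof -
  let ?A = "{f \<in> Bij V. \<forall>u\<in>V. \<forall>v\<in>V. (f u, f v) \<in> E \<longleftrightarrow> (u, v) \<in> E}"
  have mem: "f x \<in> V" if "f \<in> Bij V" "x \<in> V" for f x
    using that Bij_imp_funcset by fastforce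
  have "subgroup ?A (BijGroup V)"
  proof (rule group.subgroupI[OF group_BijGroup])
    show "?A \<subseteq> carrier (BijGroup V)" by (auto simp: BijGroup_def)
    have "(\<lambda>x\<in>V. x) \<in> ?A" using id_Bij by auto
    then show "?A \<noteq> {}" by blast
  next
    fix f assume f: "f \<in> ?A"
    have inv: "(\<lambda>x\<in>V. inv_into V f x) \<in> Bij V" using f restrict_inv_into_Bij by auto
    have V: "inv_into V f x \<in> V \<and> f (inv_into V f x) = x" if "x \<in> V" for x
      using f that by (auto simp: Bij_def bij_betw_def inv_into_into f_inv_into_f)
    have "(inv_into V f u, inv_into V f v) \<in> E \<longleftrightarrow> (u, v) \<in> E" if "u \<in> V" "v \<in> V" for u v
    proof -
      have "(f (inv_into V f u), f (inv_into V f v)) \<in> E \<longleftrightarrow>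
        (inv_into V f u, inv_into V f v) \<in> E" using f V that by blast
      then show ?thesis using V that by simp
    qed
    then show "inv\<^bsub>BijGroup V\<^esub> f \<in> ?A" using f inv by (auto simp: inv_BijGroup)
  next
    fix f g assume "f \<in> ?A" "g \<in> ?A"
    then show "f \<otimes>\<^bsub>BijGroup V\<^esub> g \<in> ?A"
      using mem by (auto simp: BijGroup_def compose_Bij compose_eq)
  qed
  then show ?thesis
    unfolding aut_group_def by (rule group.subgroup_imp_group[OF group_BijGroup])
qed

lemma end_relD:
  assumes "(r, s) \<in> end_rel V E" "S \<subseteq> V" "finite S"
  obtains C m n where "C \<in> graph_components (V - S) (Restr E (V - S))"
    "r ` {m..} \<subseteq> C" "s ` {n..} \<subseteq> C"
proof -
  have "\<forall>S. S \<subseteq> V \<and> finite S \<longrightarrow>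
      (\<exists>C \<in> graph_components (V - S) (Restr E (V - S)).
         \<exists>m n. r ` {m..} \<subseteq> C \<and> s ` {n..} \<subseteq> C)"
    using assms(1) by (simp add: end_rel_def)
  from spec[OF this, of S] show ?thesis using assms(2,3) that by (elim impE bexE exE conjE) auto
qed

lemma equiv_end_rel:
  assumes "simple_graph V E"
  shows "equiv (rays V E) (end_rel V E)"
proof (rule equivI)
  show "end_rel V E \<subseteq> rays V E \<times> rays V E" by (auto simp: end_rel_def)
  show "sym (end_rel V E)" unfolding end_rel_def by (rule symI) (simp, metis)
  have comp: "equiv (V - S) {(u, v) \<in> (V - S) \<times> (V - S). (u, v) \<in> (Restr E (V - S))\<^sup>*}" for S
  proof (rule equivI)
    have "sym (Restr E (V - S))" using assms by (auto simp: simple_graph_def sym_def)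
    then have "sym ((Restr E (V - S))\<^sup>*)" by (rule sym_rtrancl)
    then show "sym {(u, v) \<in> (V - S) \<times> (V - S). (u, v) \<in> (Restr E (V - S))\<^sup>*}"
      unfolding sym_def by blast
  qed (auto simp: refl_on_def trans_def)
  show "refl_on (rays V E) (end_rel V E)"
  proof (rule refl_onI)
    fix r assume r: "r \<in> rays V E"
    have "\<exists>C \<in> graph_components (V - S) (Restr E (V - S)). \<exists>m n. r ` {m..} \<subseteq> C \<and> r ` {n..} \<subseteq> C"
      if S: "finite S" for S
    proof -
      have "finite (r -` S)" using r S by (auto simp: rays_def intro: finite_vimageI)
      then obtain m where "r -` S \<subseteq> {..<m}" by (auto simp: finite_nat_iff_bounded)
      then have m: "r i \<notin> S" if "i \<ge> m" for i using that by force
      have V: "r i \<in> V - S" if "i \<ge> m" for i using m that r by (auto simp: rays_def)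
      have "(r m, r i) \<in> (Restr E (V - S))\<^sup>*" if "i \<ge> m" for i
        using that
      proof (induction i rule: dec_induct)
        case (step i)
        have "(r i, r (Suc i)) \<in> Restr E (V - S)"
          using r V step.hyps by (auto simp: rays_def)
        with step.IH show ?case by (rule rtrancl_into_rtrancl)
      qed simp
      then have "r ` {m..} \<subseteq> {(u, v) \<in> (V - S) \<times> (V - S). (u, v) \<in> (Restr E (V - S))\<^sup>*} `` {r m}"
        using V by auto
      moreover have "\<dots> \<in> graph_components (V - S) (Restr E (V - S))"
        unfolding graph_components_def using V by (intro quotientI) auto
      ultimately show ?thesis by blast
    qed
    then show "(r, r) \<in> end_rel V E" using r by (simp add: end_rel_def)
  qed
  show "trans (end_rel V E)"
  proof (rule transI)
    fix r s t assume rs: "(r, s) \<in> end_rel V E" and st: "(s, t) \<in> end_rel V E"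
    have "\<exists>C \<in> graph_components (V - S) (Restr E (V - S)). \<exists>m n. r ` {m..} \<subseteq> C \<and> t ` {n..} \<subseteq> C"
      if S: "S \<subseteq> V" "finite S" for S
    proof -
      obtain C m n where C: "C \<in> graph_components (V - S) (Restr E (V - S))"
        "r ` {m..} \<subseteq> C" "s ` {n..} \<subseteq> C"
        by (rule end_relD[OF rs S])
      obtain D k l where D: "D \<in> graph_components (V - S) (Restr E (V - S))"
        "s ` {k..} \<subseteq> D" "t ` {l..} \<subseteq> D"
        by (rule end_relD[OF st S])
      have "s (max n k) \<in> C" using C(3) by (simp add: image_subset_iff)
      moreover have "s (max n k) \<in> D" using D(2) by (simp add: image_subset_iff)
      ultimately have "C \<inter> D \<noteq> {}" by blast
      then have "C = D"
        using quotient_disj[OF comp C(1)[unfolded graph_components_def] D(1)[unfolded graph_components_def]]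
        by simp
      then show ?thesis using C(1,2) D(3) by blast
    qed
    moreover have "r \<in> rays V E" "t \<in> rays V E" using rs st by (simp_all add: end_rel_def)
    ultimately show "(r, t) \<in> end_rel V E" by (simp add: end_rel_def)
  qed
qed

end

theory Submission
  imports Defs
begin

text \<open>
  A countable automorphism group is discrete: by a diagonal argument
  (\<open>countable_auts_imp_rigid\<close>) only the identity fixes some ball around \<open>v\<close> pointwise.  Hence only
  finitely many automorphisms send a given vertex to another given vertex, orbits are infinite, every
  finite set can be moved off itself, and a nontrivial automorphism has infinite support: a conjugate
  with support away from the rigid ball would be trivial.  Linear growth provides a constant \<open>C\<close> such
  that for unboundedly many radii the sphere around \<open>v\<close> has at most \<open>C\<close> vertices.

  More than one end.  Some finite \<open>F\<close> with at most \<open>C\<close> boundary vertices contains a given finite set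
  \<open>D\<close>, and by submodularity of the boundary a minimal such \<open>F\<close> is invariant under the stabiliser of
  \<open>D\<close>.  If \<open>D\<close> contains the rigid ball, then the stabiliser acts faithfully on the boundary of \<open>F\<close>,
  since otherwise there would be a nontrivial automorphism supported in \<open>F\<close>.  So the order of the
  stabiliser is bounded in terms of \<open>C\<close> alone (\<open>set_stabiliser_bound\<close>).  As the group is infinite,
  there is a \<open>t\<close> such that infinitely many points of the orbit of \<open>v\<close> are reached from \<open>v\<close> by jumps of
  length at most \<open>t\<close> (\<open>exists_infinite_orbit_chain\<close>).  Such a chain must pass every cut around a large
  ball with small boundary.  Translation yields connected cuts with at most \<open>C\<close> boundary vertices,
  arbitrarily large on both sides, that all pass within distance \<open>t\<close> of \<open>v\<close> (\<open>cut_near_base\<close>).  In a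
  one-ended graph this is impossible, because each of \<open>C + 1\<close> disjoint annuli around \<open>v\<close> contains a
  boundary vertex of the cut (\<open>cut_boundary_large\<close>).

  At most two ends.  Pairwise inequivalent rays lead to distinct vertices of some sphere with at most
  \<open>C\<close> vertices, so there are at most \<open>C\<close> ends, and some ball \<open>B\<close> separates all of them.  Choose an
  automorphism \<open>g\<close> such that \<open>g ` B\<close> is disjoint from \<open>B\<close>.  All ends except at most one lie in
  components of \<open>G - B\<close> that do not contain \<open>g ` B\<close>; these components and \<open>B\<close> lie in one component
  of \<open>G - g ` B\<close>, which contains at most one end, as \<open>g ` B\<close> separates all ends too
  (\<open>card_end_representatives_le\<close>).
\<close>

(* The prefix inv denotes the inverse function below. *)
unbundle no m_inv_syntax

section \<open>Walks and balls\<close>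

text \<open>Simple graphs that are locally finite and connected.\<close>
locale lf_graph =
  fixes V :: "'a set" and E :: "('a \<times> 'a) set"
  assumes simple: "simple_graph V E"
    and lf: "locally_finite V E"
    and conn: "connected_graph V E"
begin

lemma edge_V: "(x, y) \<in> E \<Longrightarrow> x \<in> V \<and> y \<in> V"
  using simple by (auto simp: simple_graph_def)

lemma edge_sym: "(x, y) \<in> E \<Longrightarrow> (y, x) \<in> E"
  using simple by (auto simp: simple_graph_def sym_def)

lemma edge_commute: "(x, y) \<in> E \<longleftrightarrow> (y, x) \<in> E"
  using edge_sym by blast

lemma Restr_sym: "sym (Restr E X)"
  using edge_sym by (auto simp: sym_def)

lemma Restr_rtrancl_sym: "(x, y) \<in> (Restr E X)\<^sup>* \<Longrightarrow> (y, x) \<in> (Restr E X)\<^sup>*"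
  using sym_rtrancl[OF Restr_sym] by (meson symD)

lemma finite_nbrs: "finite (E `` {x})"
proof (cases "x \<in> V")
  case False
  then have "E `` {x} = {}" using edge_V by auto
  then show ?thesis by simp
qed (use lf in \<open>auto simp: locally_finite_def\<close>)

lemma finite_nbrs_set: "finite X \<Longrightarrow> finite (E `` X)"
proof -
  have "E `` X = (\<Union>x\<in>X. E `` {x})" by auto
  then show "finite X \<Longrightarrow> finite (E `` X)" using finite_nbrs by simp
qed

text \<open>The ball of radius \<open>n\<close>, described by walks; it is defined for every \<open>x\<close> of the type and agrees
  with \<^const>\<open>graph_ball\<close> for vertices.\<close>
definition nball :: "'a \<Rightarrow> nat \<Rightarrow> 'a set" where
  "nball x n = {u. \<exists>k\<le>n. (x, u) \<in> E ^^ k}"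

lemma nball_eq: "x \<in> V \<Longrightarrow> nball x n = graph_ball V E x n"
  using graph_ball_eq[OF simple] by (simp add: nball_def)

lemma nball_0 [simp]: "nball x 0 = {x}"
  by (auto simp: nball_def)

lemma centre_in_nball [simp]: "x \<in> nball x n"
  unfolding nball_def by (auto intro!: exI[of _ 0])

lemma nball_mono: "m \<le> n \<Longrightarrow> nball x m \<subseteq> nball x n"
  unfolding nball_def using le_trans by blast

lemma nball_Suc: "nball x (Suc n) = nball x n \<union> E `` nball x n"
proof (intro Set.set_eqI iffI)
  fix u assume "u \<in> nball x (Suc n)"
  then obtain k where k: "k \<le> Suc n" "(x, u) \<in> E ^^ k" by (auto simp: nball_def)
  show "u \<in> nball x n \<union> E `` nball x n"
  proof (cases "k \<le> n")
    case False
    then have "k = Suc n" using k by simp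
    then obtain y where "(x, y) \<in> E ^^ n" "(y, u) \<in> E" using k by auto
    then show ?thesis by (auto simp: nball_def)
  qed (use k in \<open>auto simp: nball_def\<close>)
next
  fix u assume "u \<in> nball x n \<union> E `` nball x n"
  then show "u \<in> nball x (Suc n)"
  proof
    assume "u \<in> E `` nball x n"
    then obtain y k where "k \<le> n" "(x, y) \<in> E ^^ k" "(y, u) \<in> E" by (auto simp: nball_def)
    then have "(x, u) \<in> E ^^ Suc k" "Suc k \<le> Suc n" by auto
    then show ?thesis unfolding nball_def by blast
  qed (use nball_mono[of n "Suc n"] in auto)
qed

lemma finite_nball [simp]: "finite (nball x n)"
  by (induction n) (auto simp: nball_Suc finite_nbrs_set)

lemma nball_V: "x \<in> V \<Longrightarrow> nball x n \<subseteq> V"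
  by (induction n) (use edge_V in \<open>auto simp: nball_Suc\<close>)

lemma relpow_sym: "(x, y) \<in> E ^^ k \<Longrightarrow> (y, x) \<in> E ^^ k"
proof (induction k arbitrary: y)
  case (Suc k)
  then obtain z where "(x, z) \<in> E ^^ k" "(z, y) \<in> E" by auto
  then have "(y, z) \<in> E" "(z, x) \<in> E ^^ k" using Suc edge_sym by auto
  then show ?case by (rule relpow_Suc_I2)
qed simp

lemma nball_sym: "y \<in> nball x n \<Longrightarrow> x \<in> nball y n"
  unfolding nball_def using relpow_sym by blast

lemma nball_trans: "y \<in> nball x m \<Longrightarrow> z \<in> nball y n \<Longrightarrow> z \<in> nball x (m + n)"
proof -
  assume "y \<in> nball x m" "z \<in> nball y n"
  then obtain k l where "k \<le> m" "l \<le> n" "(x, y) \<in> E ^^ k" "(y, z) \<in> E ^^ l"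
    by (auto simp: nball_def)
  then have "(x, z) \<in> E ^^ (k + l)" "k + l \<le> m + n" unfolding relpow_add by auto
  then show ?thesis unfolding nball_def by blast
qed

lemma in_some_nball:
  assumes "x \<in> V" "y \<in> V"
  obtains n where "y \<in> nball x n"
proof -
  have "(x, y) \<in> E\<^sup>*" using conn assms by (auto simp: connected_graph_def)
  then obtain n where "(x, y) \<in> E ^^ n" by (meson rtrancl_imp_relpow)
  then show ?thesis using that by (auto simp: nball_def)
qed

lemma finite_subset_nball:
  assumes "finite X" "X \<subseteq> V" "x \<in> V"
  obtains n where "X \<subseteq> nball x n"
proof -
  have "\<exists>n. X \<subseteq> nball x n"
    using assms(1,2)
  proof (induction X)
    case (insert y X)
    then obtain n where n: "X \<subseteq> nball x n" by auto
    obtain m where "y \<in> nball x m" using in_some_nball[of x y] assms(3) insert by auto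
    then have "insert y X \<subseteq> nball x (max m n)"
      using n nball_mono[of m "max m n" x] nball_mono[of n "max m n" x] by auto
    then show ?case by blast
  qed auto
  then show ?thesis using that by blast
qed

lemma nball_connected:
  assumes "y \<in> nball x n"
  shows "(x, y) \<in> (Restr E (nball x n))\<^sup>*"
proof -
  obtain k where "k \<le> n" "(x, y) \<in> E ^^ k" using assms by (auto simp: nball_def)
  then show ?thesis
  proof (induction k arbitrary: y)
    case (Suc k)
    then obtain z where z: "(x, z) \<in> E ^^ k" "(z, y) \<in> E" by auto
    then have "(x, z) \<in> (Restr E (nball x n))\<^sup>*" using Suc by auto
    moreover have "z \<in> nball x n" "y \<in> nball x n"
      using z Suc.prems unfolding nball_def by (auto intro: exI[of _ k] exI[of _ "Suc k"] simp del: relpow.simps)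
    ultimately show ?case using z(2) by (auto intro: rtrancl_into_rtrancl)
  qed auto
qed

text \<open>Some edge of a walk from inside a set to outside of it leaves the set.\<close>
lemma rtrancl_crossing:
  assumes "(x, y) \<in> R\<^sup>*" "x \<in> U" "y \<notin> U"
  obtains p q where "(p, q) \<in> R" "p \<in> U" "q \<notin> U"
proof -
  have "y \<in> U \<or> (\<exists>p q. (p, q) \<in> R \<and> p \<in> U \<and> q \<notin> U)"
    using assms(1)
    by (induction rule: rtrancl_induct) (use assms(2) in blast)+
  then show ?thesis using assms that by blast
qed

section \<open>Automorphisms\<close>

text \<open>Automorphisms are extended by the identity outside \<open>V\<close>; so they are permutations of the
  whole type, closed under \<open>\<circ>\<close> and \<open>inv\<close>.\<close>
definition auts :: "('a \<Rightarrow> 'a) set" where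
  "auts = {f. bij f \<and> (\<forall>x. x \<notin> V \<longrightarrow> f x = x) \<and> (\<forall>u v. (f u, f v) \<in> E \<longleftrightarrow> (u, v) \<in> E)}"

lemma aut_bij: "f \<in> auts \<Longrightarrow> bij f"
  by (simp add: auts_def)

lemma aut_inj: "f \<in> auts \<Longrightarrow> inj f"
  by (simp add: aut_bij bij_is_inj)

lemma aut_surj: "f \<in> auts \<Longrightarrow> surj f"
  by (simp add: aut_bij bij_is_surj)

lemma aut_edge: "f \<in> auts \<Longrightarrow> (f u, f v) \<in> E \<longleftrightarrow> (u, v) \<in> E"
  by (simp add: auts_def)

lemma aut_off: "f \<in> auts \<Longrightarrow> x \<notin> V \<Longrightarrow> f x = x"
  by (simp add: auts_def)

lemma aut_V: "f \<in> auts \<Longrightarrow> f x \<in> V \<longleftrightarrow> x \<in> V"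
proof -
  assume f: "f \<in> auts"
  have off: "f y = y" if "y \<notin> V" for y using f that by (auto simp: auts_def)
  show "f x \<in> V \<longleftrightarrow> x \<in> V"
    using off[of x] off[of "f x"] injD[OF aut_inj[OF f], of "f x" x] by metis
qed

lemma aut_id: "id \<in> auts"
  by (auto simp: auts_def)

lemma aut_comp: "f \<in> auts \<Longrightarrow> g \<in> auts \<Longrightarrow> f \<circ> g \<in> auts"
  by (auto simp: auts_def bij_comp)

lemma aut_inv_eq [simp]: "f \<in> auts \<Longrightarrow> f (inv f x) = x" "f \<in> auts \<Longrightarrow> inv f (f x) = x"
  using aut_surj aut_inj by (auto simp: surj_f_inv_f)

lemma aut_inv: "f \<in> auts \<Longrightarrow> inv f \<in> auts"
proof -
  assume f: "f \<in> auts"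
  have "inv f x = x" if "x \<notin> V" for x
    using f that aut_inv_eq(2)[OF f, of x] by (auto simp: auts_def)
  moreover have "(inv f u, inv f v) \<in> E \<longleftrightarrow> (u, v) \<in> E" for u v
    using aut_edge[OF f, of "inv f u" "inv f v"] f by simp
  ultimately show ?thesis using bij_imp_bij_inv[OF aut_bij[OF f]] by (simp add: auts_def)
qed

lemma aut_image_V: "f \<in> auts \<Longrightarrow> f ` V = V"
proof -
  assume f: "f \<in> auts"
  have "x \<in> f ` V" if "x \<in> V" for x
    using that f aut_V[OF aut_inv[OF f], of x] image_eqI[of x f "inv f x"] by auto
  then show ?thesis using aut_V[OF f] by blast
qed

lemma aut_image_nbrs: "f \<in> auts \<Longrightarrow> E `` (f ` X) = f ` (E `` X)"
proof -
  assume f: "f \<in> auts"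
  have "y \<in> f ` (E `` X)" if "x \<in> X" "(f x, y) \<in> E" for x y
  proof -
    have "(x, inv f y) \<in> E" using that aut_edge[OF f, of x "inv f y"] f by simp
    then show ?thesis using that f by (intro image_eqI[of _ _ "inv f y"]) auto
  qed
  moreover have "f y \<in> E `` (f ` X)" if "x \<in> X" "(x, y) \<in> E" for x y
    using that aut_edge[OF f] by blast
  ultimately show ?thesis by blast
qed

lemma aut_image_nball: "f \<in> auts \<Longrightarrow> f ` nball x n = nball (f x) n"
  by (induction n) (simp_all add: nball_Suc image_Un aut_image_nbrs[symmetric])

lemma aut_nball: "f \<in> auts \<Longrightarrow> f y \<in> nball (f x) n \<longleftrightarrow> y \<in> nball x n"
  using aut_image_nball[of f x n, symmetric] aut_inj[of f] by (simp add: inj_image_mem_iff)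

lemma aut_walk: "f \<in> auts \<Longrightarrow> (x, y) \<in> (Restr E X)\<^sup>* \<Longrightarrow> (f x, f y) \<in> (Restr E (f ` X))\<^sup>*"
proof -
  assume f: "f \<in> auts" and xy: "(x, y) \<in> (Restr E X)\<^sup>*"
  from xy show ?thesis
  proof (induction rule: rtrancl_induct)
    case (step y z)
    then have "(f y, f z) \<in> Restr E (f ` X)" using aut_edge[OF f] by auto
    with step.IH show ?case by (rule rtrancl_into_rtrancl)
  qed simp
qed

lemma auts_eq_aut_group:
  "auts = (\<lambda>f x. if x \<in> V then f x else x) ` carrier (aut_group V E)"
  "inj_on (\<lambda>f x. if x \<in> V then f x else x) (carrier (aut_group V E))"
proof -
  let ?e = "\<lambda>f x. if x \<in> V then f x else x"
  have car: "carrier (aut_group V E) =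
     {f \<in> Bij V. \<forall>u\<in>V. \<forall>v\<in>V. (f u, f v) \<in> E \<longleftrightarrow> (u, v) \<in> E}"
    by (simp add: aut_group_def)
  have "f \<in> ?e ` carrier (aut_group V E)" if f: "f \<in> auts" for f
  proof
    have "bij_betw f V V"
      using aut_image_V[OF f] aut_inj[OF f] by (auto simp: bij_betw_def inj_on_def)
    then show "restrict f V \<in> carrier (aut_group V E)"
      using aut_edge[OF f] by (auto simp: car Bij_def bij_betw_restrict_eq)
    show "f = ?e (restrict f V)" using f by (auto simp: auts_def fun_eq_iff)
  qed
  moreover have "?e f \<in> auts" if f: "f \<in> carrier (aut_group V E)" for f
  proof -
    have b: "bij_betw f V V" using f by (auto simp: car Bij_def)
    then have fV: "f x \<in> V" if "x \<in> V" for x using that bij_betwE by blast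
    have "bij_betw (?e f) V V" using b by (subst bij_betw_cong[of _ _ f]) auto
    moreover have "bij_betw (?e f) (- V) (- V)"
      by (subst bij_betw_cong[of _ _ id]) auto
    ultimately have "bij_betw (?e f) (V \<union> - V) (V \<union> - V)"
      by (rule bij_betw_combine) simp
    then have "bij (?e f)" by simp
    moreover have "(?e f u, ?e f v) \<in> E \<longleftrightarrow> (u, v) \<in> E" for u v
    proof (cases "u \<in> V \<and> v \<in> V")
      case False
      then have "(u, v) \<notin> E" "(?e f u, ?e f v) \<notin> E" using edge_V by (fastforce split: if_splits)+
      then show ?thesis by simp
    qed (use f in \<open>auto simp: car\<close>)
    ultimately show ?thesis unfolding auts_def by auto
  qed
  ultimately show "auts = ?e ` carrier (aut_group V E)" by blast
  show "inj_on ?e (carrier (aut_group V E))"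
  proof (rule inj_onI)
    fix f g assume fg: "f \<in> carrier (aut_group V E)" "g \<in> carrier (aut_group V E)" "?e f = ?e g"
    have "f x = g x" if "x \<in> V" for x using fun_cong[OF fg(3), of x] that by simp
    moreover have "f \<in> extensional V" "g \<in> extensional V" using fg by (auto simp: car Bij_def)
    ultimately show "f = g" by (intro extensionalityI) auto
  qed
qed

section \<open>Countable automorphism groups are discrete\<close>

text \<open>Otherwise a diagonal argument produces an automorphism outside any given enumeration \<open>f\<close> of the
  group.  It is the limit of automorphisms \<open>g n\<close>, where \<open>g (Suc n)\<close> agrees with \<open>g n\<close> on the ball of
  radius \<open>r n\<close> and differs from \<open>f n\<close> on the ball of radius \<open>r (Suc n)\<close>.\<close>
lemma countable_auts_imp_rigid:
  assumes "countable auts" "v \<in> V"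
  shows "\<exists>r. \<forall>\<sigma>\<in>auts. (\<forall>x\<in>nball v r. \<sigma> x = x) \<longrightarrow> \<sigma> = id"
proof (rule ccontr)
  assume "\<not> ?thesis"
  then have flex: "\<exists>\<sigma>\<in>auts. (\<forall>x\<in>nball v r. \<sigma> x = x) \<and> \<sigma> \<noteq> id" for r by blast
  define f where "f = from_nat_into auts"
  have f_auts: "f n \<in> auts" for n unfolding f_def using aut_id by (intro from_nat_into) auto
  have f_surj: "\<exists>n. f n = g" if "g \<in> auts" for g
    unfolding f_def using from_nat_into_surj[OF assms(1) that] by blast
  let ?Q = "\<lambda>n p q. snd p < snd q \<and> (\<forall>x\<in>nball v (snd p). fst q x = fst p x) \<and>
     (\<exists>x\<in>nball v (snd q). fst q x \<noteq> f n x)"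
  have "\<exists>s. \<forall>n. fst (s n) \<in> auts \<and> ?Q n (s n) (s (Suc n))"
  proof (rule dependent_nat_choice)
    show "\<exists>p :: ('a \<Rightarrow> 'a) \<times> nat. fst p \<in> auts" using aut_id by (intro exI[of _ "(id, 0)"]) auto
    fix p :: "('a \<Rightarrow> 'a) \<times> nat" and n assume p: "fst p \<in> auts"
    obtain g r where gr: "p = (g, r)" by (cases p)
    have g: "g \<in> auts" using p gr by simp
    obtain \<sigma> where \<sigma>: "\<sigma> \<in> auts" "\<forall>x\<in>nball v r. \<sigma> x = x" "\<sigma> \<noteq> id" using flex by blast
    have "g \<circ> \<sigma> \<noteq> g"
    proof
      assume "g \<circ> \<sigma> = g"
      then have "\<sigma> x = x" for x using injD[OF aut_inj[OF g], of "\<sigma> x" x] by (simp add: fun_eq_iff)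
      then show False using \<sigma>(3) by auto
    qed
    \<comment> \<open>\<open>f n\<close> cannot be equal to both \<open>g\<close> and \<open>g \<circ> \<sigma>\<close>, so one of them is a valid continuation.\<close>
    then obtain h where h: "h \<in> auts" "\<forall>x\<in>nball v r. h x = g x" "h \<noteq> f n"
      using g aut_comp[OF g \<sigma>(1)] \<sigma>(2) by (cases "f n = g") auto
    obtain x where x: "h x \<noteq> f n x" using h(3) by auto
    then have "x \<in> V" using aut_off[OF h(1)] aut_off[OF f_auts] by metis
    then obtain m where "x \<in> nball v m" using in_some_nball[OF assms(2)] by blast
    then have "x \<in> nball v (max m (Suc r))" using nball_mono[of m "max m (Suc r)" v] by auto
    then have "fst (h, max m (Suc r)) \<in> auts \<and> ?Q n p (h, max m (Suc r))"
      using h x gr by auto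
    then show "\<exists>q. fst q \<in> auts \<and> ?Q n p q" by blast
  qed
  then obtain s where s: "\<And>n. fst (s n) \<in> auts" "\<And>n. ?Q n (s n) (s (Suc n))" by blast
  define g r where "g n = fst (s n)" and "r n = snd (s n)" for n
  have g: "g n \<in> auts" for n using s(1)[of n] by (simp add: g_def)
  have r: "r n < r (Suc n)" for n using s(2)[of n] by (simp add: r_def)
  have g_Suc: "g (Suc n) x = g n x" if "x \<in> nball v (r n)" for n x
    using s(2)[of n] that by (simp add: g_def r_def)
  have diff: "\<exists>x\<in>nball v (r (Suc n)). g (Suc n) x \<noteq> f n x" for n
    using s(2)[of n] by (simp add: g_def r_def)
  have r_mono: "r m \<le> r n" if "m \<le> n" for m n
    by (rule lift_Suc_mono_le[of r, OF less_imp_le[OF r] that])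
  have r_ge: "n \<le> r n" for n
  proof (induction n)
    case (Suc n) then show ?case using r[of n] by simp
  qed simp
  have g_stable: "g n x = g m x" if "m \<le> n" "x \<in> nball v (r m)" for m n x
    using that(1)
  proof (induction n rule: dec_induct)
    case (step n)
    then have "x \<in> nball v (r n)" using that(2) nball_mono[OF r_mono] by blast
    then show ?case using g_Suc step by simp
  qed simp
  have reach: "\<exists>m. \<forall>n\<ge>m. x \<in> nball v (r n)" if "x \<in> V" for x
  proof -
    obtain m where "x \<in> nball v m" using in_some_nball[OF assms(2) \<open>x \<in> V\<close>] .
    then have "x \<in> nball v (r n)" if "n \<ge> m" for n
      using that nball_mono[of m "r n" v] r_ge[of n] by auto
    then show ?thesis by blast
  qed
  define L where "L x = (if x \<in> V then g (LEAST m. x \<in> nball v (r m)) x else x)" for x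
  have L: "L x = g m x" if "x \<in> nball v (r m)" for x m
  proof -
    have "x \<in> V" using that nball_V[OF assms(2)] by blast
    moreover have "(LEAST m. x \<in> nball v (r m)) \<le> m" using that by (rule Least_le)
    moreover have "x \<in> nball v (r (LEAST m. x \<in> nball v (r m)))" using that by (rule LeastI)
    ultimately show ?thesis using g_stable by (simp add: L_def)
  qed
  have L_ev: "\<exists>m. \<forall>n\<ge>m. L x = g n x" if "x \<in> V" for x
    using reach[OF that] L by blast
  have L_two: "\<exists>n. L x = g n x \<and> L y = g n y" if "x \<in> V" "y \<in> V" for x y
  proof -
    obtain m k where "\<forall>n\<ge>m. L x = g n x" "\<forall>n\<ge>k. L y = g n y"
      using L_ev[OF \<open>x \<in> V\<close>] L_ev[OF \<open>y \<in> V\<close>] by blast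
    then show ?thesis by (intro exI[of _ "max m k"]) simp
  qed
  have LV: "L x \<in> V \<longleftrightarrow> x \<in> V" for x
  proof (cases "x \<in> V")
    case True
    then obtain n where "L x = g n x" using L_two[of x x] by blast
    then show ?thesis using aut_V[OF g] by simp
  qed (simp add: L_def)
  have "inj L"
  proof (rule injI)
    fix x y assume xy: "L x = L y"
    show "x = y"
    proof (cases "x \<in> V")
      case True
      then have "y \<in> V" using xy LV by metis
      then obtain n where "g n x = g n y" using L_two[OF True] xy by metis
      then show ?thesis using aut_inj[OF g] by (simp add: inj_eq)
    next
      case False
      then have "y \<notin> V" using xy LV by metis
      then show ?thesis using False xy by (simp add: L_def)
    qed
  qed
  \<comment> \<open>All \<open>g m\<close> send \<open>v\<close> to \<open>L v\<close>, hence a large ball around \<open>v\<close> onto one around \<open>L v\<close> that contains \<open>y\<close>.\<close>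
  moreover have "\<exists>x. y = L x" for y
  proof (cases "y \<in> V")
    case True
    then obtain m where m: "y \<in> nball (L v) m"
      using in_some_nball[of "L v" y] LV assms(2) by blast
    have "y \<in> nball (L v) (r m)" using m nball_mono[OF r_ge[of m]] by blast
    also have "nball (L v) (r m) = g m ` nball v (r m)" using L[of v m] aut_image_nball[OF g] by simp
    finally obtain x where "x \<in> nball v (r m)" "y = g m x" by blast
    then have "y = L x" using L by simp
    then show ?thesis ..
  next
    case False
    then show ?thesis by (intro exI[of _ y]) (simp add: L_def)
  qed
  ultimately have "bij L" by (simp add: bij_def surj_def)
  moreover have "(L x, L y) \<in> E \<longleftrightarrow> (x, y) \<in> E" for x y
  proof (cases "x \<in> V \<and> y \<in> V")
    case True
    then show ?thesis using L_two[of x y] aut_edge[OF g] by metis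
  next
    case False
    then have "\<not> (L x \<in> V \<and> L y \<in> V)" using LV by simp
    then show ?thesis using False edge_V by blast
  qed
  ultimately have "L \<in> auts" by (auto simp: auts_def L_def)
  then obtain n where "f n = L" using f_surj by blast
  then show False using diff[of n] L[of _ "Suc n"] by metis
qed

section \<open>Vertex boundaries\<close>

text \<open>The outer vertex boundary: vertices outside \<open>F\<close> with a neighbour in \<open>F\<close>.\<close>
definition bd :: "'a set \<Rightarrow> 'a set" where
  "bd F = E `` F - F"

lemma finite_bd: "finite F \<Longrightarrow> finite (bd F)"
  by (simp add: bd_def finite_nbrs_set)

lemma aut_image_bd: "f \<in> auts \<Longrightarrow> f ` bd F = bd (f ` F)"
  unfolding bd_def by (simp add: aut_image_nbrs image_set_diff aut_inj)

lemma bd_submodular: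
  assumes "finite A" "finite B"
  shows "card (bd (A \<union> B)) + card (bd (A \<inter> B)) \<le> card (bd A) + card (bd B)"
proof -
  let ?N = "\<lambda>X. X \<union> E `` X"
  have N: "card (?N X) = card X + card (bd X)" if "finite X" for X
  proof -
    have "card (X \<union> bd X) = card X + card (bd X)"
      using that finite_bd by (intro card_Un_disjoint) (auto simp: bd_def)
    moreover have "X \<union> bd X = ?N X" by (auto simp: bd_def)
    ultimately show ?thesis by simp
  qed
  have fin: "finite (?N A)" "finite (?N B)" using assms finite_nbrs_set by auto
  have "card (?N (A \<inter> B)) \<le> card (?N A \<inter> ?N B)"
    using fin by (intro card_mono) auto
  moreover have "?N (A \<union> B) = ?N A \<union> ?N B" by auto
  moreover note card_Un_Int[OF fin] card_Un_Int[OF assms] N[of A] N[of B] N[of "A \<union> B"] N[of "A \<inter> B"] assms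
  ultimately show ?thesis by simp
qed

text \<open>If almost all spheres had more than \<open>C \<ge> c\<close> vertices, the balls would outgrow \<open>c * n\<close>.\<close>
lemma linear_growth_small_spheres:
  assumes "linear_growth V E" "v \<in> V"
  shows "\<exists>C. \<forall>N. \<exists>n\<ge>N. card (bd (nball v n)) \<le> C"
proof -
  obtain c :: real where c: "\<And>n. n \<ge> 1 \<Longrightarrow> card (nball v n) \<le> c * n"
    using assms linear_growth_iff[OF simple lf conn assms(2)] nball_eq[OF assms(2)] by auto
  obtain C :: nat where C: "c \<le> C" using real_arch_simple by blast
  have card_Suc: "card (nball v (Suc n)) = card (nball v n) + card (bd (nball v n))" for n
  proof -
    have "nball v (Suc n) = nball v n \<union> bd (nball v n)" by (auto simp: nball_Suc bd_def)
    then show ?thesis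
      using card_Un_disjoint[of "nball v n" "bd (nball v n)"] finite_bd by (auto simp: bd_def)
  qed
  have "\<exists>n\<ge>N. card (bd (nball v n)) \<le> C" for N
  proof (rule ccontr)
    assume "\<not> ?thesis"
    then have big: "card (bd (nball v n)) \<ge> Suc C" if "n \<ge> N" for n using that by force
    have grow: "card (nball v (N + k)) \<ge> k * Suc C" for k
    proof (induction k)
      case (Suc k)
      then show ?case using card_Suc[of "N + k"] big[of "N + k"] by simp
    qed simp
    define k where "k = Suc (C * N)"
    have "real (k * Suc C) \<le> card (nball v (N + k))" using grow[of k] by (rule of_nat_mono)
    also have "\<dots> \<le> c * (N + k)" using c[of "N + k"] by (simp add: k_def)
    also have "\<dots> \<le> real C * real (N + k)" using C by (intro mult_right_mono) auto
    finally have "k * Suc C \<le> C * (N + k)" by (metis of_nat_le_iff of_nat_mult)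
    then show False by (simp add: k_def algebra_simps)
  qed
  then show ?thesis by blast
qed

end

section \<open>Infinite discrete automorphism groups\<close>

text \<open>The group is infinite, and only the identity fixes the ball of radius \<open>\<rho>\<close> around \<open>v\<close>
  pointwise.\<close>
locale rigid_graph = lf_graph +
  fixes v :: 'a and \<rho> :: nat
  assumes base: "v \<in> V"
    and rigid: "\<And>\<sigma>. \<sigma> \<in> auts \<Longrightarrow> (\<And>x. x \<in> nball v \<rho> \<Longrightarrow> \<sigma> x = x) \<Longrightarrow> \<sigma> = id"
    and infinite_auts: "infinite auts"
begin

lemma aut_eqI:
  assumes "g \<in> auts" "h \<in> auts" "\<And>x. x \<in> nball v \<rho> \<Longrightarrow> g x = h x"
  shows "g = h"
proof -
  have "inv h \<circ> g = id"
    using assms by (intro rigid aut_comp aut_inv) auto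
  then have "h (inv h (g x)) = h x" for x by (metis comp_apply id_apply)
  then show ?thesis using assms(2) by auto
qed

text \<open>An automorphism is determined by its restriction to the rigid ball, and \<open>g x = y\<close> confines the
  image of this ball to a ball around \<open>y\<close>.\<close>
lemma finite_transporter:
  assumes "x \<in> V"
  shows "finite {g \<in> auts. g x = y}"
proof -
  let ?B = "nball v \<rho>"
  obtain m where m: "?B \<subseteq> nball x m" using finite_subset_nball[of ?B x] nball_V base assms by auto
  let ?r = "\<lambda>g. restrict g ?B"
  have "inj_on ?r {g \<in> auts. g x = y}"
  proof (rule inj_onI)
    fix g h assume gh: "g \<in> {g \<in> auts. g x = y}" "h \<in> {g \<in> auts. g x = y}" "?r g = ?r h"
    then have "g u = h u" if "u \<in> ?B" for u using that by (metis restrict_apply')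
    then show "g = h" using gh by (intro aut_eqI) auto
  qed
  moreover have "?r ` {g \<in> auts. g x = y} \<subseteq> ?B \<rightarrow>\<^sub>E nball y m"
    using m aut_nball by fastforce
  moreover have "finite (?B \<rightarrow>\<^sub>E nball y m)" by (simp add: finite_PiE)
  ultimately show ?thesis by (meson finite_imageD finite_subset)
qed

lemma infinite_orbit:
  assumes "x \<in> V"
  shows "infinite ((\<lambda>g. g x) ` auts)"
proof
  assume fin: "finite ((\<lambda>g. g x) ` auts)"
  have "auts \<subseteq> (\<Union>y\<in>(\<lambda>g. g x) ` auts. {g \<in> auts. g x = y})" by auto
  moreover have "finite \<dots>" using fin finite_transporter[OF assms] by blast
  ultimately show False using infinite_auts finite_subset by blast
qed

lemma infinite_V: "infinite V"
proof
  assume "finite V"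
  moreover have "(\<lambda>g. g v) ` auts \<subseteq> V" using aut_V base by auto
  ultimately show False using infinite_orbit[OF base] finite_subset by blast
qed

text \<open>Only finitely many automorphisms send some vertex of \<open>X\<close> into \<open>Y\<close>.\<close>
lemma displacement:
  assumes "finite X" "finite Y" "X \<subseteq> V"
  obtains g where "g \<in> auts" "g ` X \<inter> Y = {}"
proof -
  let ?T = "\<Union>x\<in>X. \<Union>y\<in>Y. {g \<in> auts. g x = y}"
  have "finite ?T" using assms finite_transporter by (intro finite_UN_I) auto
  then have "\<not> auts \<subseteq> ?T" using infinite_auts finite_subset by blast
  then obtain g where "g \<in> auts" "g \<notin> ?T" by blast
  then show ?thesis using that[of g] by auto
qed

text \<open>Some conjugate of \<open>\<sigma>\<close> has its support disjoint from the rigid ball, so it is trivial.\<close>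
lemma finite_support_aut:
  assumes "\<sigma> \<in> auts" "finite F" "\<And>x. x \<notin> F \<Longrightarrow> \<sigma> x = x"
  shows "\<sigma> = id"
proof -
  obtain g where g: "g \<in> auts" "g ` (F \<inter> V) \<inter> nball v \<rho> = {}"
    using displacement[of "F \<inter> V" "nball v \<rho>"] assms(2) by auto
  have "g \<circ> \<sigma> \<circ> inv g = id"
  proof (rule rigid)
    show "g \<circ> \<sigma> \<circ> inv g \<in> auts" by (intro aut_comp aut_inv g(1) assms(1))
    fix x assume x: "x \<in> nball v \<rho>"
    have "inv g x \<notin> F \<inter> V"
    proof
      assume "inv g x \<in> F \<inter> V"
      then have "g (inv g x) \<in> g ` (F \<inter> V)" by (rule imageI)
      then show False using g x by auto
    qed
    then have "\<sigma> (inv g x) = inv g x" using assms(3) aut_off[OF assms(1)] by blast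
    then show "(g \<circ> \<sigma> \<circ> inv g) x = x" using g by simp
  qed
  then have "g (\<sigma> (inv g (g x))) = g x" for x by (simp add: fun_eq_iff)
  then have "\<sigma> x = x" for x using g(1) aut_inj[OF g(1)] by (simp add: inj_eq)
  then show ?thesis by auto
qed

text \<open>An automorphism that preserves \<open>F\<close> and fixes its boundary can be cut off outside \<open>F\<close>, which
  gives an automorphism of finite support.\<close>
lemma boundary_action_faithful:
  assumes "finite F" "nball v \<rho> \<subseteq> F" "\<sigma> \<in> auts" "\<sigma> ` F = F" "\<And>x. x \<in> bd F \<Longrightarrow> \<sigma> x = x"
  shows "\<sigma> = id"
proof -
  define \<tau> where "\<tau> x = (if x \<in> F then \<sigma> x else x)" for x
  have "bij_betw \<tau> F F"
    using assms(4) aut_inj[OF assms(3)]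
    by (subst bij_betw_cong[of _ _ \<sigma>]) (auto simp: \<tau>_def bij_betw_def inj_on_def)
  moreover have "bij_betw \<tau> (- F) (- F)"
    by (subst bij_betw_cong[of _ _ id]) (auto simp: \<tau>_def)
  ultimately have "bij_betw \<tau> (F \<union> - F) (F \<union> - F)" by (rule bij_betw_combine) simp
  then have "bij \<tau>" by simp
  have mixed: "(\<sigma> x, y) \<in> E \<longleftrightarrow> (x, y) \<in> E" if "x \<in> F" "y \<notin> F" for x y
  proof (cases "y \<in> bd F")
    case True
    then show ?thesis using assms(5) aut_edge[OF assms(3), of x y] by simp
  next
    case False
    have "\<sigma> x \<in> F" using assms(4) that by auto
    then show ?thesis using False that by (auto simp: bd_def)
  qed
  have "(\<tau> x, \<tau> y) \<in> E \<longleftrightarrow> (x, y) \<in> E" for x y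
    using mixed[of x y] mixed[of y x] aut_edge[OF assms(3), of x y]
      edge_commute[of x y] edge_commute[of x "\<sigma> y"]
    by (auto simp: \<tau>_def)
  then have "\<tau> \<in> auts" using \<open>bij \<tau>\<close> assms(3) by (auto simp: auts_def \<tau>_def)
  then have "\<tau> = id" using assms(1) by (rule finite_support_aut) (simp add: \<tau>_def)
  show ?thesis
  proof (rule rigid[OF assms(3)])
    fix x assume "x \<in> nball v \<rho>"
    then have "\<tau> x = \<sigma> x" using assms(2) by (auto simp: \<tau>_def)
    then show "\<sigma> x = x" using \<open>\<tau> = id\<close> by simp
  qed
qed

end

section \<open>Set stabilisers have bounded order\<close>

text \<open>The boundary of the ball of radius \<open>n\<close> is the sphere of radius \<open>n + 1\<close>; for unboundedly many radii
  it has at most \<open>C\<close> vertices.\<close>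
locale thin_graph = rigid_graph +
  fixes C :: nat
  assumes small_spheres: "\<And>N. \<exists>n\<ge>N. card (bd (nball v n)) \<le> C"
begin

text \<open>Among the finite supersets of \<open>D\<close> with the smallest boundary take \<open>F\<close> of least cardinality.  If
  \<open>g\<close> preserves \<open>D\<close>, then by submodularity \<open>F \<inter> g ` F\<close> again has the smallest boundary, so it is
  \<open>F\<close>.\<close>
lemma invariant_cut:
  assumes "finite D" "D \<subseteq> V"
  obtains F where "finite F" "D \<subseteq> F" "card (bd F) \<le> C"
    "\<And>g. g \<in> auts \<Longrightarrow> g ` D = D \<Longrightarrow> g ` F = F"
proof -
  let ?P = "\<lambda>F. finite F \<and> D \<subseteq> F"
  obtain m where m: "D \<subseteq> nball v m" using finite_subset_nball[OF assms base] .
  obtain n where n: "n \<ge> m" "card (bd (nball v n)) \<le> C" using small_spheres by blast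
  have Pn: "?P (nball v n)" using m nball_mono[OF n(1)] by auto
  obtain F0 where F0: "?P F0" and min0: "\<And>F. ?P F \<Longrightarrow> card (bd F0) \<le> card (bd F)"
    using ex_has_least_nat[of ?P "nball v n" "\<lambda>F. card (bd F)"] Pn by blast
  let ?Q = "\<lambda>F. ?P F \<and> card (bd F) = card (bd F0)"
  obtain F where F: "?Q F" and min: "\<And>F'. ?Q F' \<Longrightarrow> card F \<le> card F'"
    using ex_has_least_nat[of ?Q F0 card] F0 by blast
  have "g ` F = F" if g: "g \<in> auts" "g ` D = D" for g
  proof -
    have fin: "finite F" "finite (g ` F)" using F by auto
    have Pg: "D \<subseteq> g ` F" using F g(2) by blast
    have "card (bd (g ` F)) = card (bd F)"
      using aut_inj[OF g(1)] by (simp add: aut_image_bd[OF g(1), symmetric] card_image inj_on_subset)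
    then have "card (bd (F \<union> g ` F)) + card (bd (F \<inter> g ` F)) \<le> 2 * card (bd F0)"
      using bd_submodular[OF fin] F by simp
    moreover have "card (bd F0) \<le> card (bd (F \<union> g ` F))" "card (bd F0) \<le> card (bd (F \<inter> g ` F))"
      using F Pg by (auto intro!: min0)
    ultimately have "?Q (F \<inter> g ` F)" using F Pg by auto
    then have "card F \<le> card (F \<inter> g ` F)" by (rule min)
    then have "F \<inter> g ` F = F" using fin by (intro card_seteq) auto
    then have "F \<subseteq> g ` F" by blast
    moreover have "card (g ` F) = card F"
      using aut_inj[OF g(1)] by (simp add: card_image inj_on_subset)
    ultimately show ?thesis using fin card_subset_eq by metis
  qed
  moreover have "card (bd F) \<le> C" using F min0[OF Pn] n(2) by simp
  ultimately show ?thesis using F that by blast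
qed

text \<open>The stabiliser acts faithfully on the at most \<open>C\<close> boundary vertices of an invariant \<open>F\<close>.  What
  matters is that the bound does not depend on \<open>D\<close>.\<close>
lemma set_stabiliser_bound:
  assumes "finite D" "D \<subseteq> V" "nball v \<rho> \<subseteq> D"
  shows "finite {g \<in> auts. g ` D = D} \<and> card {g \<in> auts. g ` D = D} \<le> Suc C ^ Suc C"
proof -
  obtain F where F: "finite F" "D \<subseteq> F" "card (bd F) \<le> C"
    and inv: "\<And>g. g \<in> auts \<Longrightarrow> g ` D = D \<Longrightarrow> g ` F = F"
    using invariant_cut[OF assms(1,2)] by blast
  let ?H = "{g \<in> auts. g ` D = D}" and ?r = "\<lambda>g. restrict g (bd F)"
  have gbd: "g ` bd F = bd F" if "g \<in> ?H" for g
    using that inv aut_image_bd by auto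
  have inj: "inj_on ?r ?H"
  proof (rule inj_onI)
    fix g h assume gh: "g \<in> ?H" "h \<in> ?H" "?r g = ?r h"
    then have agree: "g x = h x" if "x \<in> bd F" for x using that by (metis restrict_apply')
    have "g ` F = h ` F" using inv[of g] inv[of h] gh by simp
    then have "(inv h \<circ> g) ` F = inv h ` h ` F" by (metis image_comp)
    also have "\<dots> = F" using gh by (simp add: image_comp comp_def)
    finally have "inv h \<circ> g = id"
      using gh F assms(3) agree by (intro boundary_action_faithful[of F] aut_comp aut_inv) auto
    then have "h (inv h (g x)) = h x" for x by (metis comp_apply id_apply)
    then show "g = h" using gh by auto
  qed
  have sub: "?r ` ?H \<subseteq> bd F \<rightarrow>\<^sub>E bd F"
    using gbd by fastforce
  have fin: "finite (bd F \<rightarrow>\<^sub>E bd F)" using F finite_bd by (simp add: finite_PiE)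
  have "finite ?H" using inj_on_finite[OF inj sub fin] .
  moreover have "card ?H \<le> card (bd F \<rightarrow>\<^sub>E bd F)" using card_inj_on_le[OF inj sub fin] .
  moreover have "card (bd F \<rightarrow>\<^sub>E bd F) = card (bd F) ^ card (bd F)"
    using F finite_bd by (simp add: card_PiE)
  moreover have "card (bd F) ^ card (bd F) \<le> Suc C ^ card (bd F)"
    using F by (intro power_mono) auto
  moreover have "Suc C ^ card (bd F) \<le> Suc C ^ Suc C"
    using F by (intro power_increasing) auto
  ultimately show ?thesis by linarith
qed

text \<open>Pairs of points in the orbit of \<open>v\<close> at distance at most \<open>t\<close>.\<close>
definition orbit_step :: "nat \<Rightarrow> ('a \<times> 'a) set" where
  "orbit_step t = {(x, y). x \<in> (\<lambda>g. g v) ` auts \<and> y \<in> (\<lambda>g. g v) ` auts \<and> y \<in> nball x t}"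

text \<open>The orbit points that can be reached from \<open>v\<close> by jumps of length at most \<open>t\<close> within the orbit.\<close>
definition orbit_chain :: "nat \<Rightarrow> 'a set" where
  "orbit_chain t = (orbit_step t)\<^sup>* `` {v}"

lemma aut_orbit_step:
  assumes "g \<in> auts" "(x, y) \<in> orbit_step t"
  shows "(g x, g y) \<in> orbit_step t"
proof -
  have "g (h v) \<in> (\<lambda>g. g v) ` auts" if "h \<in> auts" for h
    using aut_comp[OF assms(1) that] by (metis comp_apply imageI)
  then show ?thesis using assms aut_nball[OF assms(1)] by (auto simp: orbit_step_def)
qed

lemma aut_orbit_steps:
  assumes "g \<in> auts" "(x, y) \<in> (orbit_step t)\<^sup>*"
  shows "(g x, g y) \<in> (orbit_step t)\<^sup>*"
  using assms(2)
proof (induction rule: rtrancl_induct)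
  case (step y z)
  show ?case using step.IH aut_orbit_step[OF assms(1) step.hyps(2)] by (rule rtrancl_into_rtrancl)
qed simp

lemma orbit_chain_orbit: "orbit_chain t \<subseteq> (\<lambda>g. g v) ` auts"
proof
  fix y assume "y \<in> orbit_chain t"
  then have "(v, y) \<in> (orbit_step t)\<^sup>*" by (simp add: orbit_chain_def)
  then show "y \<in> (\<lambda>g. g v) ` auts"
  proof cases
    case base
    then show ?thesis using aut_id by (metis id_apply imageI)
  qed (auto simp: orbit_step_def)
qed

text \<open>Suppose that all chains are finite.  Any finite set \<open>A\<close> of automorphisms moves \<open>v\<close> by at most some
  \<open>t\<close>; then each element of \<open>A\<close> preserves the \<open>t\<close>-chain of \<open>v\<close> and the union \<open>D\<close> of the
  \<open>\<rho>\<close>-balls around it.  This bounds the size of \<open>A\<close>, although the group is infinite.\<close>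
lemma exists_infinite_orbit_chain: "\<exists>t. infinite (orbit_chain t)"
proof (rule ccontr)
  assume "\<not> ?thesis"
  then have fin: "finite (orbit_chain t)" for t by blast
  let ?M = "Suc C ^ Suc C"
  obtain A where A: "A \<subseteq> auts" "finite A" "card A = Suc ?M"
    using infinite_arbitrarily_large[OF infinite_auts] by blast
  have "finite ((\<lambda>g. g v) ` A)" "(\<lambda>g. g v) ` A \<subseteq> V" using A aut_V base by auto
  then obtain t where t: "(\<lambda>g. g v) ` A \<subseteq> nball v t" using finite_subset_nball base by metis
  define D where "D = (\<Union>x\<in>orbit_chain t. nball x \<rho>)"
  have v: "v \<in> orbit_chain t" by (simp add: orbit_chain_def)
  have "orbit_chain t \<subseteq> V" using orbit_chain_orbit[of t] aut_V base by auto
  then have D: "finite D" "D \<subseteq> V" "nball v \<rho> \<subseteq> D"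
    using fin v unfolding D_def by (simp, intro UN_least nball_V, blast, blast)
  have "g ` D = D" if "g \<in> A" for g
  proof -
    have g: "g \<in> auts" using that A by auto
    have "g v \<in> nball v t" using t that by auto
    moreover have "g v \<in> (\<lambda>g. g v) ` auts" "v \<in> (\<lambda>g. g v) ` auts"
      using g aut_id by (auto intro: image_eqI[of _ _ id])
    ultimately have step: "(v, g v) \<in> orbit_step t" by (simp add: orbit_step_def)
    have "g ` orbit_chain t \<subseteq> orbit_chain t"
      using aut_orbit_steps[OF g] step by (auto simp: orbit_chain_def intro: converse_rtrancl_into_rtrancl)
    then have "g ` orbit_chain t = orbit_chain t"
      using fin aut_inj[OF g] by (intro endo_inj_surj) (auto intro: inj_on_subset)
    then have "D = (\<Union>x\<in>g ` orbit_chain t. nball x \<rho>)" by (simp add: D_def)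
    also have "\<dots> = g ` D" using aut_image_nball[OF g] by (simp add: D_def image_UN)
    finally show ?thesis by simp
  qed
  then have "A \<subseteq> {g \<in> auts. g ` D = D}" using A by auto
  then have "card A \<le> card {g \<in> auts. g ` D = D}"
    using set_stabiliser_bound[OF D] by (intro card_mono) auto
  also have "\<dots> \<le> ?M" using set_stabiliser_bound[OF D] by blast
  finally show False using A by linarith
qed

end

context lf_graph
begin

section \<open>Connected cuts in one-ended graphs\<close>

text \<open>\<open>(x, y) \<in> off S\<close> for vertices outside \<open>S\<close>: they lie in the same component of \<open>G - S\<close>.\<close>
abbreviation off :: "'a set \<Rightarrow> ('a \<times> 'a) set" where
  "off S \<equiv> (Restr E (V - S))\<^sup>*"

lemma off_common: "(x, y) \<in> off S \<Longrightarrow> (x, z) \<in> off S \<Longrightarrow> (y, z) \<in> off S"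
  by (rule rtrancl_trans[OF Restr_rtrancl_sym])

lemma Restr_walk_mono: "X \<subseteq> Y \<Longrightarrow> (x, y) \<in> (Restr E X)\<^sup>* \<Longrightarrow> (x, y) \<in> (Restr E Y)\<^sup>*"
  by (rule subsetD[OF rtrancl_mono]) auto

lemma Restr_walk_end: "(x, y) \<in> (Restr E X)\<^sup>* \<Longrightarrow> x \<in> X \<Longrightarrow> y \<in> X"
  by (induction rule: rtrancl_induct) auto

lemma Restr_walk_finite:
  assumes "(x, y) \<in> (Restr E X)\<^sup>*"
  shows "\<exists>P. finite P \<and> P \<subseteq> X \<and> (x, y) \<in> (Restr E P)\<^sup>*"
  using assms
proof (induction rule: rtrancl_induct)
  case (step y z)
  then obtain P where P: "finite P" "P \<subseteq> X" "(x, y) \<in> (Restr E P)\<^sup>*" by blast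
  let ?P = "insert y (insert z P)"
  have "(x, y) \<in> (Restr E ?P)\<^sup>*" using P(3) by (rule Restr_walk_mono[rotated]) auto
  moreover have "(y, z) \<in> Restr E ?P" using step by auto
  ultimately have "(x, z) \<in> (Restr E ?P)\<^sup>*" by (rule rtrancl_into_rtrancl)
  then show ?case using P step by (intro exI[of _ ?P]) auto
qed auto

lemma walk_V: "x \<in> V \<Longrightarrow> y \<in> V \<Longrightarrow> (x, y) \<in> E\<^sup>*"
  using conn by (auto simp: connected_graph_def)

text \<open>Every component of \<open>G - S\<close> contains a boundary vertex of \<open>S\<close>, as \<open>G\<close> is connected.\<close>
lemma component_meets_bd:
  assumes "x \<in> V - S" "s \<in> S" "s \<in> V"
  shows "\<exists>z\<in>bd S. (z, x) \<in> off S"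
proof -
  have "(x, s) \<in> E\<^sup>*" using assms walk_V by auto
  then have "x \<notin> S \<longrightarrow> (\<exists>z\<in>bd S. (z, x) \<in> off S)"
  proof (induction rule: converse_rtrancl_induct)
    case (step x y)
    show ?case
    proof (intro impI)
      assume x: "x \<notin> S"
      show "\<exists>z\<in>bd S. (z, x) \<in> off S"
      proof (cases "y \<in> S")
        case True
        then have "x \<in> bd S" using x step(1) edge_sym by (auto simp: bd_def)
        then show ?thesis by blast
      next
        case False
        then obtain z where "z \<in> bd S" "(z, y) \<in> off S" using step by blast
        moreover have "(y, x) \<in> Restr E (V - S)" using step(1) edge_sym edge_V x False by auto
        ultimately show ?thesis by (meson rtrancl_into_rtrancl)
      qed
    qed
  qed (use assms in auto)
  then show ?thesis using assms by auto
qed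

text \<open>\<open>X\<close> induces a connected subgraph; the empty set is allowed.\<close>
definition induced_connected :: "'a set \<Rightarrow> bool" where
  "induced_connected X \<longleftrightarrow> (\<forall>x\<in>X. \<forall>y\<in>X. (x, y) \<in> (Restr E X)\<^sup>*)"

lemma induced_connectedI:
  assumes "\<And>y. y \<in> X \<Longrightarrow> (x, y) \<in> (Restr E X)\<^sup>*"
  shows "induced_connected X"
  unfolding induced_connected_def
  using rtrancl_trans[OF Restr_rtrancl_sym[OF assms] assms] by blast

lemma nball_induced_connected: "induced_connected (nball x n)"
  by (rule induced_connectedI) (rule nball_connected)

lemma induced_connected_off:
  assumes "induced_connected X" "X \<subseteq> V" "X \<inter> S = {}" "x \<in> X" "y \<in> X"
  shows "(x, y) \<in> off S"
proof (rule Restr_walk_mono)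
  show "X \<subseteq> V - S" using assms(2,3) by auto
  show "(x, y) \<in> (Restr E X)\<^sup>*" using assms(1,4,5) by (simp add: induced_connected_def)
qed

lemma induced_connected_image:
  assumes "f \<in> auts" "induced_connected X"
  shows "induced_connected (f ` X)"
  using assms aut_walk[OF assms(1)] by (auto simp: induced_connected_def)

lemma induced_connected_exit:
  assumes "induced_connected X" "X \<inter> S \<noteq> {}" "\<not> X \<subseteq> S"
  shows "X \<inter> bd S \<noteq> {}"
proof -
  obtain x y where "x \<in> X" "x \<in> S" "y \<in> X" "y \<notin> S" using assms by blast
  then obtain p q where "(p, q) \<in> Restr E X" "p \<in> S" "q \<notin> S"
    using rtrancl_crossing[of x y "Restr E X" S] assms(1) by (auto simp: induced_connected_def)
  then show ?thesis by (auto simp: bd_def)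
qed

text \<open>For each finite \<open>S\<close>, all but finitely many vertices lie in a single component of \<open>G - S\<close>.  For an
  infinite locally finite connected graph this means that there is exactly one end.\<close>
definition one_ended :: bool where
  "one_ended \<longleftrightarrow> (\<forall>S. finite S \<and> S \<subseteq> V \<longrightarrow>
     (\<exists>S'. finite S' \<and> S' \<subseteq> V \<and> (\<forall>x\<in>V - S'. \<forall>y\<in>V - S'. (x, y) \<in> off S)))"

text \<open>Both sides of the cut \<open>W\<close> are connected, meet \<open>S\<close>, and leave \<open>T\<close>.\<close>
definition splits :: "'a set \<Rightarrow> 'a set \<Rightarrow> 'a set \<Rightarrow> bool" where
  "splits W S T \<longleftrightarrow> W \<subseteq> V \<and> induced_connected W \<and> induced_connected (V - W) \<and>
     S \<inter> W \<noteq> {} \<and> S - W \<noteq> {} \<and> \<not> W \<subseteq> T \<and> \<not> V - W \<subseteq> T"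

lemma splits_mono: "splits W S T \<Longrightarrow> S \<subseteq> S' \<Longrightarrow> T' \<subseteq> T \<Longrightarrow> splits W S' T'"
  unfolding splits_def by blast

text \<open>Let \<open>S' \<supseteq> S\<close> be finite such that all vertices outside \<open>S'\<close> are joined in \<open>G - S\<close>, and let \<open>T\<close>
  contain \<open>S'\<close> and, for any two boundary vertices of \<open>S'\<close>, a walk \<open>P\<close> outside \<open>S\<close> between them.  Both
  sides of the cut \<open>W\<close> leave \<open>S'\<close> through its boundary, so one of these walks crosses the cut.\<close>
lemma cut_beyond_finite_set:
  assumes "one_ended" "finite S" "S \<subseteq> V"
  shows "\<exists>T. finite T \<and> T \<subseteq> V \<and> S \<subseteq> T \<and>
    (\<forall>W. splits W S T \<longrightarrow> bd W \<inter> (T - S) \<noteq> {})"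
proof -
  obtain S'' where S'': "finite S''" "S'' \<subseteq> V" "\<forall>x\<in>V - S''. \<forall>y\<in>V - S''. (x, y) \<in> off S"
    using assms(1)[unfolded one_ended_def, THEN spec[of _ S]] assms(2,3) by blast
  define S' where "S' = S'' \<union> S"
  have S': "finite S'" "S' \<subseteq> V" using S'' assms by (auto simp: S'_def)
  have bdS': "finite (bd S')" "bd S' \<subseteq> V - S'"
    using S' finite_bd edge_V by (auto simp: bd_def)
  have "\<exists>P. finite P \<and> P \<subseteq> V - S \<and> (a, b) \<in> (Restr E P)\<^sup>*" if "a \<in> bd S'" "b \<in> bd S'" for a b
    using that S''(3) bdS' by (intro Restr_walk_finite) (auto simp: S'_def)
  then obtain P where P: "\<And>a b. a \<in> bd S' \<Longrightarrow> b \<in> bd S' \<Longrightarrow>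
    finite (P a b) \<and> P a b \<subseteq> V - S \<and> (a, b) \<in> (Restr E (P a b))\<^sup>*" by metis
  define T where "T = S' \<union> (\<Union>a\<in>bd S'. \<Union>b\<in>bd S'. P a b)"
  have "finite T" "T \<subseteq> V" "S \<subseteq> T" using S' bdS' P by (auto simp: T_def S'_def)
  moreover have "bd W \<inter> (T - S) \<noteq> {}"
    if "splits W S T" for W
  proof -
    note W = that[unfolded splits_def]
    have "W \<inter> bd S' \<noteq> {}" "(V - W) \<inter> bd S' \<noteq> {}"
      using W assms(3) by (intro induced_connected_exit; auto simp: T_def S'_def)+
    then obtain a b where a: "a \<in> bd S'" "a \<in> W" and b: "b \<in> bd S'" "b \<notin> W" by blast
    have "(a, b) \<in> (Restr E (P a b))\<^sup>*" using P[OF a(1) b(1)] by blast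
    then obtain p q where "(p, q) \<in> Restr E (P a b)" "p \<in> W" "q \<notin> W"
      using a(2) b(2) by (rule rtrancl_crossing)
    moreover have "P a b \<subseteq> T - S" using P[OF a(1) b(1)] a b by (auto simp: T_def)
    ultimately show ?thesis by (auto simp: bd_def)
  qed
  ultimately show ?thesis by blast
qed

text \<open>Iteration over disjoint annuli: a cut that starts in \<open>S\<close> and reaches far enough on both sides has
  a large boundary.\<close>
lemma cut_boundary_large:
  assumes "one_ended" "finite S" "S \<subseteq> V"
  shows "\<exists>T. finite T \<and> T \<subseteq> V \<and> S \<subseteq> T \<and>
    (\<forall>W. splits W S T \<longrightarrow> k \<le> card (bd W \<inter> T))"
proof (induction k)
  case 0
  then show ?case using assms by auto
next
  case (Suc k)
  obtain T where T: "finite T" "T \<subseteq> V" "S \<subseteq> T" and Tk: "\<And>W. splits W S T \<Longrightarrow> k \<le> card (bd W \<inter> T)"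
    using Suc by blast
  obtain T' where T': "finite T'" "T' \<subseteq> V" "T \<subseteq> T'"
    and meet: "\<And>W. splits W T T' \<Longrightarrow> bd W \<inter> (T' - T) \<noteq> {}"
    using cut_beyond_finite_set[OF assms(1) T(1,2)] by blast
  have "Suc k \<le> card (bd W \<inter> T')" if W: "splits W S T'" for W
  proof -
    have "splits W S T" "splits W T T'" using splits_mono[OF W] T T' by auto
    then obtain x where x: "x \<in> bd W" "x \<in> T' - T" and k: "k \<le> card (bd W \<inter> T)"
      using meet Tk by blast
    have "Suc k \<le> card (insert x (bd W \<inter> T))" using x k T by simp
    also have "\<dots> \<le> card (bd W \<inter> T')" using x T' by (intro card_mono) auto
    finally show ?thesis .
  qed
  then show ?case using T T' by (intro exI[of _ T']) auto
qed

end

context thin_graph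
begin

text \<open>The component \<open>U\<close> of a far orbit point \<open>w\<close> in the complement of a ball \<open>B\<close> with small boundary
  gives a cut with small boundary and two large sides.  A chain of orbit points from \<open>v\<close> to \<open>w\<close> passes
  the cut, so some translate of the cut passes within distance \<open>t\<close> of \<open>v\<close>, however large \<open>B\<close> is.\<close>
lemma cut_near_base:
  assumes "infinite (orbit_chain t)"
  shows "\<exists>W\<subseteq>V. induced_connected W \<and> induced_connected (V - W) \<and> nball v t \<inter> W \<noteq> {} \<and>
    nball v t - W \<noteq> {} \<and> finite (bd W) \<and> card (bd W) \<le> C \<and>
    (\<forall>T. finite T \<and> card T \<le> k \<longrightarrow> \<not> W \<subseteq> T \<and> \<not> V - W \<subseteq> T)"
proof -
  obtain X where X: "X \<subseteq> V" "finite X" "card X = Suc k"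
    using infinite_arbitrarily_large[OF infinite_V] by blast
  obtain N where N: "X \<subseteq> nball v N" using finite_subset_nball[OF X(2,1) base] .
  obtain n where n: "n \<ge> N" "card (bd (nball v n)) \<le> C" using small_spheres by blast
  define B where "B = nball v n"
  have card_B: "k < card B"
  proof -
    have "X \<subseteq> B" using N nball_mono[OF n(1), of v] by (auto simp: B_def)
    then have "card X \<le> card B" by (intro card_mono) (simp_all add: B_def)
    then show ?thesis using X by simp
  qed
  have B_V: "B \<subseteq> V" using nball_V[OF base] by (simp add: B_def)
  have B_conn: "induced_connected B" unfolding B_def by (rule nball_induced_connected)
  have vB: "v \<in> B" by (simp add: B_def)
  \<comment> \<open>With radius \<open>n + n\<close>, the translate of \<open>B\<close> around \<open>w\<close> is disjoint from \<open>B\<close>; so \<open>U\<close> is as large as \<open>B\<close>.\<close>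
  obtain w where w: "w \<in> orbit_chain t" "w \<notin> nball v (n + n)"
    using assms finite_subset[of "orbit_chain t" "nball v (n + n)"] by auto
  obtain h where h: "h \<in> auts" "w = h v" using w orbit_chain_orbit by blast
  have wB: "nball w n \<inter> B = {}"
    using w(2) nball_trans[of _ v n w n] nball_sym by (fastforce simp: B_def)
  have wV: "w \<in> V" using h aut_V base by simp
  define U where "U = off B `` {w}"
  define W where "W = V - U"
  have w_out: "w \<in> V - B" using wV wB centre_in_nball by blast
  have U: "U \<subseteq> V - B" unfolding U_def using Restr_walk_end[OF _ w_out] by blast
  have B_W: "B \<subseteq> W" using U B_V by (auto simp: W_def)
  have VW: "V - W = U" using U by (auto simp: W_def)
  have edge_U: "y \<in> U" if "x \<in> U" "(x, y) \<in> E" "y \<notin> B" for x y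
  proof -
    have "(x, y) \<in> Restr E (V - B)" using that U edge_V[OF that(2)] by auto
    then show ?thesis using that(1) by (auto simp: U_def intro: rtrancl_into_rtrancl)
  qed
  have U_conn: "induced_connected U"
  proof (rule induced_connectedI)
    fix y assume "y \<in> U"
    then have "(w, y) \<in> off B" by (simp add: U_def)
    then show "(w, y) \<in> (Restr E U)\<^sup>*"
    proof (induction rule: rtrancl_induct)
      case (step y z)
      then have "(y, z) \<in> Restr E U"
        by (auto simp: U_def intro: rtrancl_into_rtrancl)
      with step.IH show ?case by (rule rtrancl_into_rtrancl)
    qed simp
  qed
  have W_conn: "induced_connected W"
  proof (rule induced_connectedI)
    fix x assume x: "x \<in> W"
    have "(x, v) \<in> E\<^sup>*" using x base walk_V by (auto simp: W_def)
    then have "x \<in> W \<longrightarrow> (x, v) \<in> (Restr E W)\<^sup>*"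
    proof (induction rule: converse_rtrancl_induct)
      case (step x y)
      show ?case
      proof
        assume x: "x \<in> W"
        show "(x, v) \<in> (Restr E W)\<^sup>*"
        proof (cases "y \<in> W")
          case True
          then have "(x, y) \<in> Restr E W" using x step by auto
          then show ?thesis using step True by (auto intro: converse_rtrancl_into_rtrancl)
        next
          case False
          then have "y \<in> U" using edge_V[OF step(1)] by (auto simp: W_def)
          then have "x \<in> B" using edge_U[OF _ edge_sym[OF step(1)]] x by (auto simp: W_def)
          then have "(x, v) \<in> (Restr E B)\<^sup>*" using B_conn vB by (auto simp: induced_connected_def)
          then show ?thesis by (rule Restr_walk_mono[OF B_W])
        qed
      qed
    qed simp
    then show "(v, x) \<in> (Restr E W)\<^sup>*" using x Restr_rtrancl_sym by blast
  qed
  have "bd W \<subseteq> bd B"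
  proof
    fix p assume "p \<in> bd W"
    then obtain q where q: "q \<in> W" "(q, p) \<in> E" "p \<notin> W" by (auto simp: bd_def)
    then have p: "p \<in> U" using edge_V[OF q(2)] by (auto simp: W_def)
    then have "q \<in> B" using edge_U[OF p edge_sym[OF q(2)]] q(1) by (auto simp: W_def)
    then show "p \<in> bd B" using q p U by (auto simp: bd_def)
  qed
  moreover have finB: "finite (bd B)" by (simp add: B_def finite_bd)
  ultimately have bdW: "finite (bd W)" "card (bd W) \<le> C"
    using n(2) card_mono[OF finB, of "bd W"] finite_subset[of "bd W" "bd B"] by (auto simp: B_def)
  have "nball w n \<subseteq> U"
  proof
    fix x assume "x \<in> nball w n"
    then have "(w, x) \<in> off B"
      using nball_induced_connected nball_V[OF wV] wB by (intro induced_connected_off) auto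
    then show "x \<in> U" by (simp add: U_def)
  qed
  moreover have "card (nball w n) = card B"
    using aut_inj[OF h(1)] by (simp add: B_def h(2) aut_image_nball[OF h(1), symmetric] card_image inj_on_subset)
  ultimately have large: "\<not> W \<subseteq> T \<and> \<not> U \<subseteq> T" if "finite T" "card T \<le> k" for T
    using card_B B_W that card_mono[of T B] card_mono[of T "nball w n"] by auto

  \<comment> \<open>The chain of orbit points jumps from \<open>W\<close> to \<open>U\<close>; the jump is moved back to the base point.\<close>
  have "(v, w) \<in> (orbit_step t)\<^sup>*" "v \<in> W" "w \<notin> W"
    using w(1) B_W vB by (auto simp: orbit_chain_def W_def U_def)
  then obtain x y where xy: "(x, y) \<in> orbit_step t" "x \<in> W" "y \<notin> W"
    using rtrancl_crossing[of v w "orbit_step t" W] by blast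
  then obtain g where g: "g \<in> auts" "x = g v" and y: "y \<in> nball x t" by (auto simp: orbit_step_def)
  define f where "f = inv g"
  have f: "f \<in> auts" "f x = v" using g aut_inv by (auto simp: f_def)
  have ft: "f ` nball x t = nball v t" using aut_image_nball[OF f(1)] f(2) by simp
  have VW': "V - f ` W = f ` U"
    using aut_image_V[OF f(1)] image_set_diff[OF aut_inj[OF f(1)], of V W] VW by simp
  have "f ` W \<subseteq> V" using aut_V[OF f(1)] by (auto simp: W_def)
  moreover have "induced_connected (f ` W)" "induced_connected (V - f ` W)"
    unfolding VW' using f induced_connected_image W_conn U_conn by auto
  moreover have "f x \<in> nball v t \<inter> f ` W" using xy f by auto
  moreover have "f y \<in> nball v t - f ` W"
    using xy(3) y ft aut_inj[OF f(1)] by (auto simp: inj_image_mem_iff)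
  moreover have "finite (bd (f ` W))" "card (bd (f ` W)) \<le> C"
    using bdW aut_inj[OF f(1)]
    by (simp_all add: aut_image_bd[OF f(1), symmetric] card_image inj_on_subset)
  moreover have "\<not> f ` W \<subseteq> T \<and> \<not> V - f ` W \<subseteq> T" if T: "finite T" "card T \<le> k" for T
  proof -
    have "card (g ` T) = card T"
      using aut_inj[OF g(1)] by (simp add: card_image inj_on_subset)
    then have "\<not> W \<subseteq> g ` T \<and> \<not> U \<subseteq> g ` T" using T by (intro large) auto
    moreover have "Y \<subseteq> g ` T" if "f ` Y \<subseteq> T" for Y
    proof
      fix u assume "u \<in> Y"
      then have "f u \<in> T" using that by auto
      then show "u \<in> g ` T" using g by (intro image_eqI[of _ _ "f u"]) (auto simp: f_def)
    qed
    ultimately show ?thesis unfolding VW' by blast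
  qed
  ultimately show ?thesis by (intro exI[of _ "f ` W"]) blast
qed

lemma not_one_ended: "\<not> one_ended"
proof
  assume "one_ended"
  obtain t where t: "infinite (orbit_chain t)" using exists_infinite_orbit_chain ..
  obtain T where T: "finite T" and big: "\<And>W. splits W (nball v t) T \<Longrightarrow> Suc C \<le> card (bd W \<inter> T)"
    using cut_boundary_large[OF \<open>one_ended\<close> finite_nball nball_V[OF base], of t "Suc C"] by blast
  obtain W where W: "W \<subseteq> V" "induced_connected W" "induced_connected (V - W)" "nball v t \<inter> W \<noteq> {}"
    "nball v t - W \<noteq> {}" "finite (bd W)" "card (bd W) \<le> C"
    "\<And>T'. finite T' \<Longrightarrow> card T' \<le> card T \<Longrightarrow> \<not> W \<subseteq> T' \<and> \<not> V - W \<subseteq> T'"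
    using cut_near_base[OF t, of "card T"] by blast
  have "splits W (nball v t) T" unfolding splits_def using W(1-5) W(8)[OF T] by simp
  then have "Suc C \<le> card (bd W \<inter> T)" by (rule big)
  also have "\<dots> \<le> card (bd W)" using W by (intro card_mono) auto
  finally show False using W by simp
qed

end

section \<open>Rays and ends\<close>

text \<open>Koenig's lemma.  The ray is geodesic: \<open>r i\<close> has depth \<open>i\<close>, the least number of steps from \<open>x\<close>,
  and has infinitely many descendants.\<close>
lemma infinite_reachable_imp_ray:
  assumes fin: "\<And>y. finite (R `` {y})" and inf: "infinite (R\<^sup>* `` {x})"
  obtains r :: "nat \<Rightarrow> 'a" where "r 0 = x" "inj r" "\<And>i. (r i, r (Suc i)) \<in> R"
proof -
  define d where "d z = (LEAST n. (x, z) \<in> R ^^ n)" for z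
  define D where "D y = {z. \<exists>k. (y, z) \<in> R ^^ k \<and> d z = d y + k}" for y
  have d_le: "d z \<le> n" if "(x, z) \<in> R ^^ n" for z n using that by (auto simp: d_def intro: Least_le)
  have d: "(x, z) \<in> R ^^ d z" if "(x, z) \<in> R\<^sup>*" for z
    using rtrancl_imp_relpow[OF that] unfolding d_def by (auto intro: LeastI)
  have "d x = 0" using d_le[of x 0] by simp
  then have "R\<^sup>* `` {x} \<subseteq> D x" using d by (auto simp: D_def)
  then have Dx: "infinite (D x)" using inf finite_subset by blast
  have step: "\<exists>z. (x, z) \<in> R\<^sup>* \<and> infinite (D z) \<and> (y, z) \<in> R \<and> d z = Suc (d y)"
    if y: "(x, y) \<in> R\<^sup>*" "infinite (D y)" for y
  proof (rule ccontr)
    assume none: "\<not> ?thesis"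
    let ?Z = "{z \<in> R `` {y}. d z = Suc (d y)}"
    have "D y \<subseteq> insert y (\<Union>z\<in>?Z. D z)"
    proof
      fix u assume "u \<in> D y"
      then obtain k where k: "(y, u) \<in> R ^^ k" "d u = d y + k" by (auto simp: D_def)
      show "u \<in> insert y (\<Union>z\<in>?Z. D z)"
      proof (cases k)
        case (Suc l)
        then obtain z where z: "(y, z) \<in> R" "(z, u) \<in> R ^^ l" using k(1) relpow_Suc_D2 by metis
        have xz: "(x, z) \<in> R\<^sup>*" using y(1) z(1) by (rule rtrancl_into_rtrancl)
        have "(x, u) \<in> R ^^ (d z + l)" using d[OF xz] z(2) by (rule relpow_trans)
        then have "d y + k \<le> d z + l" using d_le k(2) by metis
        moreover have "(x, z) \<in> R ^^ Suc (d y)" using d[OF y(1)] z(1) by auto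
        then have "d z \<le> Suc (d y)" by (rule d_le)
        ultimately have "d z = Suc (d y)" using Suc by simp
        then have "z \<in> ?Z" "u \<in> D z" using z k(2) Suc by (auto simp: D_def)
        then show ?thesis by blast
      qed (use k in auto)
    qed
    moreover have "finite (\<Union>z\<in>?Z. D z)"
    proof (rule finite_UN_I)
      show "finite ?Z" by (rule finite_subset[OF _ fin[of y]]) auto
      show "finite (D z)" if "z \<in> ?Z" for z
        using none that y(1) by (auto intro: rtrancl_into_rtrancl)
    qed
    ultimately have "finite (D y)" by (meson finite_insert finite_subset)
    then show False using y(2) by simp
  qed
  let ?P = "\<lambda>y. (x, y) \<in> R\<^sup>* \<and> infinite (D y)"
  obtain r where r: "r 0 = x" "\<And>n. ?P (r n)" "\<And>n. (r n, r (Suc n)) \<in> R \<and> d (r (Suc n)) = Suc (d (r n))"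
  proof -
    have "\<exists>r. \<forall>n. (?P (r n) \<and> (n = 0 \<longrightarrow> r n = x)) \<and> ((r n, r (Suc n)) \<in> R \<and> d (r (Suc n)) = Suc (d (r n)))"
      by (rule dependent_nat_choice) (use Dx step in auto)
    then show ?thesis using that by auto
  qed
  have "d (r n) = n" for n using r(1,3) \<open>d x = 0\<close> by (induction n) auto
  then have "inj r" by (rule inj_on_inverseI)
  then show ?thesis using r that by blast
qed

context lf_graph
begin

lemma rayD:
  assumes "r \<in> rays V E"
  shows "r i \<in> V" "inj r" "(r i, r (Suc i)) \<in> E"
  using assms by (auto simp: rays_def)

text \<open>The tail of \<open>r\<close> from index \<open>m\<close> on avoids \<open>S\<close>.\<close>
definition tail_avoids :: "(nat \<Rightarrow> 'a) \<Rightarrow> nat \<Rightarrow> 'a set \<Rightarrow> bool" where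
  "tail_avoids r m S \<longleftrightarrow> (\<forall>k\<ge>m. r k \<notin> S)"

lemma tail_avoids_antimono: "tail_avoids r m S \<Longrightarrow> T \<subseteq> S \<Longrightarrow> tail_avoids r m T"
  unfolding tail_avoids_def by blast

lemma ray_tail_avoids:
  assumes "r \<in> rays V E" "finite S"
  obtains m where "tail_avoids r m S"
proof -
  have "finite (r -` S)" using rayD(2)[OF assms(1)] assms(2) by (simp add: finite_vimageI)
  then obtain m where "r -` S \<subseteq> {..<m}" using finite_nat_iff_bounded by blast
  then have "tail_avoids r m S" unfolding tail_avoids_def by force
  then show ?thesis by (rule that)
qed

lemma ray_tail_off:
  assumes "r \<in> rays V E" "tail_avoids r m S" "m \<le> n"
  shows "(r m, r n) \<in> off S"
  using assms(3)
proof (induction n rule: dec_induct)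
  case (step n)
  then have "r n \<notin> S" "r (Suc n) \<notin> S" using assms(2) by (simp_all add: tail_avoids_def)
  then have "(r n, r (Suc n)) \<in> Restr E (V - S)" using rayD[OF assms(1)] by auto
  with step.IH show ?case by (rule rtrancl_into_rtrancl)
qed simp

lemma off_mono: "S \<subseteq> T \<Longrightarrow> (x, y) \<in> off T \<Longrightarrow> (x, y) \<in> off S"
  by (rule Restr_walk_mono[OF Diff_mono[OF order_refl]])

text \<open>One walk between the tails suffices, as a tail that avoids \<open>S\<close> stays in its component.\<close>
lemma end_rel_iff:
  "(r, s) \<in> end_rel V E \<longleftrightarrow> r \<in> rays V E \<and> s \<in> rays V E \<and>
     (\<forall>S. S \<subseteq> V \<and> finite S \<longrightarrow>
        (\<exists>i j. tail_avoids r i S \<and> tail_avoids s j S \<and> (r i, s j) \<in> off S))"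
  (is "?L \<longleftrightarrow> ?R")
proof
  assume L: ?L
  have "\<exists>i j. tail_avoids r i S \<and> tail_avoids s j S \<and> (r i, s j) \<in> off S"
    if S: "S \<subseteq> V" "finite S" for S
  proof -
    obtain K i j where K: "K \<in> graph_components (V - S) (Restr E (V - S))"
      "r ` {i..} \<subseteq> K" "s ` {j..} \<subseteq> K" by (rule end_relD[OF L S])
    obtain x where "K = {(u, v) \<in> (V - S) \<times> (V - S). (u, v) \<in> off S} `` {x}"
      using K(1) by (auto simp: graph_components_def elim: quotientE)
    then have K_off: "y \<in> V - S \<and> (x, y) \<in> off S" if "y \<in> K" for y using that by auto
    have "r i \<in> K" "s j \<in> K" using K by auto
    then have "(x, r i) \<in> off S" "(x, s j) \<in> off S" using K_off by blast+
    then have "(r i, s j) \<in> off S" using rtrancl_trans[OF Restr_rtrancl_sym] by blast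
    moreover have "tail_avoids r i S" "tail_avoids s j S"
      using K(2,3) K_off by (auto simp: tail_avoids_def image_subset_iff)
    ultimately show ?thesis by blast
  qed
  then show ?R using L by (simp add: end_rel_def)
next
  assume R: ?R
  have "\<exists>K \<in> graph_components (V - S) (Restr E (V - S)). \<exists>m n. r ` {m..} \<subseteq> K \<and> s ` {n..} \<subseteq> K"
    if S: "S \<subseteq> V" "finite S" for S
  proof -
    obtain i j where ij: "tail_avoids r i S" "tail_avoids s j S" "(r i, s j) \<in> off S"
      using R S by blast
    let ?K = "{(u, v) \<in> (V - S) \<times> (V - S). (u, v) \<in> off S} `` {r i}"
    have rV: "r k \<in> V - S" if "i \<le> k" for k using ij(1) that R rayD(1) by (simp add: tail_avoids_def)
    have sV: "s k \<in> V - S" if "j \<le> k" for k using ij(2) that R rayD(1) by (simp add: tail_avoids_def)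
    have "?K \<in> graph_components (V - S) (Restr E (V - S))"
      unfolding graph_components_def using rV[of i] by (intro quotientI) simp
    moreover have "r ` {i..} \<subseteq> ?K" using rV ray_tail_off[OF _ ij(1)] R by auto
    moreover have "s ` {j..} \<subseteq> ?K"
      using rV[of i] sV rtrancl_trans[OF ij(3) ray_tail_off[OF _ ij(2)]] R by auto
    ultimately show ?thesis by blast
  qed
  then show ?L using R by (simp add: end_rel_def)
qed

lemma end_rel_trans: "(r, s) \<in> end_rel V E \<Longrightarrow> (s, t) \<in> end_rel V E \<Longrightarrow> (r, t) \<in> end_rel V E"
  using equiv_end_rel[OF simple] unfolding equiv_def by (blast dest: transD)

lemma end_rel_sym: "(r, s) \<in> end_rel V E \<Longrightarrow> (s, r) \<in> end_rel V E"
  using equiv_end_rel[OF simple] unfolding equiv_def by (blast dest: symD)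

lemma end_relD_off:
  assumes "(r, s) \<in> end_rel V E" "S \<subseteq> V" "finite S" "tail_avoids r i S" "tail_avoids s j S"
  shows "(r i, s j) \<in> off S"
proof -
  have rs: "r \<in> rays V E" "s \<in> rays V E" using assms(1) end_rel_iff by blast+
  obtain k l where kl: "tail_avoids r k S" "tail_avoids s l S" "(r k, s l) \<in> off S"
    using assms(1-3) end_rel_iff by blast
  have join: "(t m, t n) \<in> off S"
    if "t \<in> rays V E" "tail_avoids t m S" "tail_avoids t n S" for t m n
    using ray_tail_off[OF that(1,2), of n] ray_tail_off[OF that(1,3), of m] Restr_rtrancl_sym
    by (cases "m \<le> n") auto
  show ?thesis
    by (rule rtrancl_trans[OF join[OF rs(1) assms(4) kl(1)]
          rtrancl_trans[OF kl(3) join[OF rs(2) kl(2) assms(5)]]])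
qed

lemma aut_ray: "f \<in> auts \<Longrightarrow> r \<in> rays V E \<Longrightarrow> f \<circ> r \<in> rays V E"
  by (auto simp: rays_def aut_V aut_edge intro: inj_compose aut_inj)

lemma aut_walk_off:
  assumes "f \<in> auts"
  shows "(f x, f y) \<in> off (f ` S) \<longleftrightarrow> (x, y) \<in> off S"
proof -
  have V: "g ` (V - X) = V - g ` X" if "g \<in> auts" for g X
    using image_set_diff[OF aut_inj[OF that]] aut_image_V[OF that] by simp
  have "inv f ` f ` S = S" using assms by (simp add: image_comp comp_def)
  then show ?thesis
    using aut_walk[OF assms, of x y "V - S"] aut_walk[OF aut_inv[OF assms], of "f x" "f y" "V - f ` S"]
      V[OF assms] V[OF aut_inv[OF assms]] assms by auto
qed

lemma aut_end_rel:
  assumes "f \<in> auts" "(r, s) \<in> end_rel V E"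
  shows "(f \<circ> r, f \<circ> s) \<in> end_rel V E"
proof -
  have "\<exists>i j. tail_avoids (f \<circ> r) i S \<and> tail_avoids (f \<circ> s) j S \<and> ((f \<circ> r) i, (f \<circ> s) j) \<in> off S"
    if S: "S \<subseteq> V" "finite S" for S
  proof -
    let ?S = "inv f ` S"
    have "?S \<subseteq> V" "finite ?S" using S aut_V[OF aut_inv[OF assms(1)]] by auto
    then obtain i j where ij: "tail_avoids r i ?S" "tail_avoids s j ?S" "(r i, s j) \<in> off ?S"
      using assms(2) end_rel_iff by blast
    have fS: "f ` ?S = S" using assms(1) by (simp add: image_comp comp_def)
    have "tail_avoids (f \<circ> t) m S" if "tail_avoids t m ?S" for t m
      unfolding tail_avoids_def
    proof (intro allI impI notI)
      fix k assume "m \<le> k" "(f \<circ> t) k \<in> S"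
      then have "inv f (f (t k)) \<in> ?S" by simp
      then show False using that \<open>m \<le> k\<close> assms(1) by (simp add: tail_avoids_def)
    qed
    moreover have "((f \<circ> r) i, (f \<circ> s) j) \<in> off S"
      using ij(3) aut_walk_off[OF assms(1), of "r i" "s j" ?S] fS by simp
    ultimately show ?thesis using ij by blast
  qed
  moreover have "f \<circ> r \<in> rays V E" "f \<circ> s \<in> rays V E"
    using assms aut_ray end_rel_iff by blast+
  ultimately show ?thesis unfolding end_rel_iff by blast
qed

lemma infinite_component_ray:
  assumes "x \<in> V - S" "infinite (off S `` {x})"
  obtains r where "r \<in> rays V E" "\<And>i. (x, r i) \<in> off S" "tail_avoids r 0 S"
proof -
  have "finite (Restr E (V - S) `` {y})" for y
    by (rule finite_subset[OF _ finite_nbrs[of y]]) auto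
  then obtain r where r: "r 0 = x" "inj r" "\<And>i. (r i, r (Suc i)) \<in> Restr E (V - S)"
    using infinite_reachable_imp_ray[OF _ assms(2)] by blast
  have "(x, r i) \<in> off S" for i
    by (induction i) (use r(1,3) in \<open>auto intro: rtrancl_into_rtrancl\<close>)
  moreover have "r \<in> rays V E" "tail_avoids r 0 S" using r by (auto simp: rays_def tail_avoids_def)
  ultimately show ?thesis using that by blast
qed

text \<open>Each component of \<open>G - S\<close> meets the finite boundary of \<open>S\<close>.  With the finite components added to
  \<open>S\<close>, two vertices outside that are not joined in \<open>G - S\<close> lie in distinct infinite components.\<close>
lemma not_one_ended_rays:
  assumes "\<not> one_ended"
  obtains r s where "r \<in> rays V E" "s \<in> rays V E" "(r, s) \<notin> end_rel V E"
proof -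
  obtain S where S_bad: "\<not> (finite S \<and> S \<subseteq> V \<longrightarrow>
     (\<exists>S'. finite S' \<and> S' \<subseteq> V \<and> (\<forall>x\<in>V - S'. \<forall>y\<in>V - S'. (x, y) \<in> off S)))"
    using assms unfolding one_ended_def not_all ..
  then have S: "finite S" "S \<subseteq> V" by simp_all
  have apart: "\<exists>x\<in>V - S'. \<exists>y\<in>V - S'. (x, y) \<notin> off S" if "finite S'" "S' \<subseteq> V" for S'
    using S_bad that by simp
  have "S \<noteq> {}"
  proof
    assume "S = {}"
    moreover have "Restr E V = E" using edge_V by auto
    ultimately show False using apart[of "{}"] walk_V by auto
  qed
  then obtain s0 where s0: "s0 \<in> S" by blast
  define S' where "S' = S \<union> (\<Union>z\<in>{z\<in>bd S. finite (off S `` {z})}. off S `` {z})"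
  have bdV: "bd S \<subseteq> V - S" using edge_V by (auto simp: bd_def)
  have "finite S'" using S finite_bd by (auto simp: S'_def)
  moreover have "S' \<subseteq> V" using S bdV Restr_walk_end[of _ _ "V - S"] by (fastforce simp: S'_def)
  ultimately obtain x y where xy: "x \<in> V - S'" "y \<in> V - S'" "(x, y) \<notin> off S" using apart by blast
  have inf: "u \<in> V - S \<and> infinite (off S `` {u})" if "u \<in> V - S'" for u
  proof -
    have u: "u \<in> V - S" using that by (auto simp: S'_def)
    then obtain z where z: "z \<in> bd S" "(z, u) \<in> off S"
      using component_meets_bd[OF u s0] s0 S by blast
    then have "infinite (off S `` {z})" using that by (auto simp: S'_def)
    moreover have "off S `` {z} \<subseteq> off S `` {u}"
      using Restr_rtrancl_sym[OF z(2)] by (auto intro: rtrancl_trans)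
    ultimately show ?thesis using u finite_subset by blast
  qed
  obtain r where r: "r \<in> rays V E" "\<And>i. (x, r i) \<in> off S" "tail_avoids r 0 S"
    using infinite_component_ray inf[OF xy(1)] by blast
  obtain s where s: "s \<in> rays V E" "\<And>i. (y, s i) \<in> off S" "tail_avoids s 0 S"
    using infinite_component_ray inf[OF xy(2)] by blast
  have "(r, s) \<notin> end_rel V E"
  proof
    assume "(r, s) \<in> end_rel V E"
    then have "(r 0, s 0) \<in> off S" using S r(3) s(3) by (intro end_relD_off) auto
    then have "(x, y) \<in> off S"
      by (intro rtrancl_trans[OF r(2)] rtrancl_trans[OF _ Restr_rtrancl_sym[OF s(2)]])
    then show False using xy(3) by blast
  qed
  then show ?thesis using that r s by blast
qed

lemma inequivalent_rays_separated:
  assumes "r \<in> rays V E" "s \<in> rays V E" "(r, s) \<notin> end_rel V E" "x \<in> V"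
  obtains N where "\<And>n i j. N \<le> n \<Longrightarrow> tail_avoids r i (nball x n) \<Longrightarrow> tail_avoids s j (nball x n) \<Longrightarrow>
     (r i, s j) \<notin> off (nball x n)"
proof -
  obtain S where S: "S \<subseteq> V" "finite S"
    and sep: "\<And>i j. tail_avoids r i S \<Longrightarrow> tail_avoids s j S \<Longrightarrow> (r i, s j) \<notin> off S"
    using assms(1-3) unfolding end_rel_iff by blast
  obtain N where N: "S \<subseteq> nball x N" using finite_subset_nball[OF S(2,1) assms(4)] .
  have "(r i, s j) \<notin> off (nball x n)"
    if "N \<le> n" "tail_avoids r i (nball x n)" "tail_avoids s j (nball x n)" for n i j
  proof -
    have Sn: "S \<subseteq> nball x n" using N nball_mono[OF that(1)] by blast
    have "(r i, s j) \<notin> off S"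
      by (rule sep[OF tail_avoids_antimono[OF that(2) Sn] tail_avoids_antimono[OF that(3) Sn]])
    then show ?thesis using off_mono[OF Sn] by blast
  qed
  then show ?thesis by (rule that)
qed

lemma inequivalent_ray_set_separated:
  assumes "finite R" "R \<subseteq> rays V E" "\<And>r s. r \<in> R \<Longrightarrow> s \<in> R \<Longrightarrow> r \<noteq> s \<Longrightarrow> (r, s) \<notin> end_rel V E" "x \<in> V"
  obtains N where "\<And>r s n i j. r \<in> R \<Longrightarrow> s \<in> R \<Longrightarrow> r \<noteq> s \<Longrightarrow> N \<le> n \<Longrightarrow>
     tail_avoids r i (nball x n) \<Longrightarrow> tail_avoids s j (nball x n) \<Longrightarrow> (r i, s j) \<notin> off (nball x n)"
proof -
  let ?sep = "\<lambda>r s n. \<forall>i j. tail_avoids r i (nball x n) \<longrightarrow> tail_avoids s j (nball x n) \<longrightarrow>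
    (r i, s j) \<notin> off (nball x n)"
  have "\<exists>N. \<forall>n\<ge>N. ?sep r s n" if "r \<in> R" "s \<in> R" "r \<noteq> s" for r s
  proof -
    have "r \<in> rays V E" "s \<in> rays V E" using that assms(2) by auto
    from inequivalent_rays_separated[OF this assms(3)[OF that] assms(4)] show ?thesis by metis
  qed
  then obtain N where N: "\<And>r s n. r \<in> R \<Longrightarrow> s \<in> R \<Longrightarrow> r \<noteq> s \<Longrightarrow> N r s \<le> n \<Longrightarrow> ?sep r s n"
    by metis
  let ?M = "Max ((\<lambda>(r, s). N r s) ` (R \<times> R))"
  have "N r s \<le> ?M" if "r \<in> R" "s \<in> R" for r s
    using that assms(1) by (intro Max_ge) (auto intro: image_eqI[of _ _ "(r, s)"])
  then have "?sep r s n" if "r \<in> R" "s \<in> R" "r \<noteq> s" "?M \<le> n" for r s n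
    using that by (intro N) (auto intro: order_trans)
  then show ?thesis using that by blast
qed

end

section \<open>The number of ends\<close>

context thin_graph
begin

text \<open>Separate the rays by a ball with small boundary; each of them lies in a component of its own,
  which uses up a boundary vertex.\<close>
lemma card_inequivalent_rays_le:
  assumes "finite R" "R \<subseteq> rays V E" "\<And>r s. r \<in> R \<Longrightarrow> s \<in> R \<Longrightarrow> r \<noteq> s \<Longrightarrow> (r, s) \<notin> end_rel V E"
  shows "card R \<le> C"
proof -
  obtain N where N: "\<And>r s n i j. r \<in> R \<Longrightarrow> s \<in> R \<Longrightarrow> r \<noteq> s \<Longrightarrow> N \<le> n \<Longrightarrow>
     tail_avoids r i (nball v n) \<Longrightarrow> tail_avoids s j (nball v n) \<Longrightarrow> (r i, s j) \<notin> off (nball v n)"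
    using inequivalent_ray_set_separated[OF assms base] by blast
  obtain n where n: "n \<ge> N" "card (bd (nball v n)) \<le> C" using small_spheres by blast
  let ?B = "nball v n"
  have "\<exists>z i. z \<in> bd ?B \<and> tail_avoids r i ?B \<and> (z, r i) \<in> off ?B" if "r \<in> R" for r
  proof -
    have r: "r \<in> rays V E" using that assms(2) by auto
    obtain i where i: "tail_avoids r i ?B" using ray_tail_avoids[OF r finite_nball] .
    then have "r i \<in> V - ?B" using rayD(1)[OF r] by (simp add: tail_avoids_def)
    then show ?thesis using component_meets_bd[OF _ centre_in_nball base] i by blast
  qed
  then obtain z i where zi: "\<And>r. r \<in> R \<Longrightarrow> z r \<in> bd ?B \<and> tail_avoids r (i r) ?B \<and> (z r, r (i r)) \<in> off ?B"
    by metis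
  have "inj_on z R"
  proof (rule inj_onI, rule ccontr)
    fix r s assume rs: "r \<in> R" "s \<in> R" "z r = z s" "r \<noteq> s"
    have "(r (i r), z r) \<in> off ?B" "(z r, s (i s)) \<in> off ?B"
      using zi[OF rs(1)] zi[OF rs(2)] rs(3) Restr_rtrancl_sym by auto
    then have "(r (i r), s (i s)) \<in> off ?B" by (rule rtrancl_trans)
    then show False using N[OF rs(1,2,4) n(1)] zi[OF rs(1)] zi[OF rs(2)] by blast
  qed
  moreover have "z ` R \<subseteq> bd ?B" using zi by auto
  ultimately have "card R \<le> card (bd ?B)" by (rule card_inj_on_le) (simp add: finite_bd)
  then show ?thesis using n(2) by simp
qed

text \<open>A component of \<open>G - B\<close> that is disjoint from the moved ball \<open>g ` B\<close> can be reached from the base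
  point without meeting \<open>g ` B\<close>.\<close>
lemma walk_around_moved_ball:
  assumes "g \<in> auts" "g ` nball v n \<inter> nball v n = {}" "x \<in> V - nball v n"
    "(g v, x) \<notin> off (nball v n)"
  shows "(v, x) \<in> off (g ` nball v n)"
proof -
  let ?B = "nball v n"
  let ?gB = "g ` ?B"
  have gB: "?gB = nball (g v) n" using aut_image_nball[OF assms(1)] .
  have gv: "g v \<in> V" using aut_V[OF assms(1)] base by simp
  obtain z where z: "z \<in> bd ?B" "(z, x) \<in> off ?B"
    using component_meets_bd[OF assms(3) centre_in_nball base] by blast
  define K where "K = off ?B `` {x}"
  have KV: "K \<subseteq> V - ?B" unfolding K_def using Restr_walk_end[OF _ assms(3)] by blast
  have "K \<inter> ?gB = {}"
  proof (rule ccontr)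
    assume "K \<inter> ?gB \<noteq> {}"
    then obtain y where y: "(x, y) \<in> off ?B" "y \<in> nball (g v) n" by (auto simp: K_def gB)
    have "(g v, y) \<in> off ?B"
      using nball_induced_connected nball_V[OF gv] assms(2) y(2)
      by (intro induced_connected_off[of "nball (g v) n"]) (auto simp: gB)
    then have "(g v, x) \<in> off ?B" using Restr_rtrancl_sym[OF y(1)] by (rule rtrancl_trans)
    then show False using assms(4) by blast
  qed
  have "(x, z) \<in> off ?B" using z(2) by (rule Restr_rtrancl_sym)
  then have "(x, z) \<in> (Restr E K)\<^sup>*"
  proof (induction rule: rtrancl_induct)
    case (step y w)
    then have "(y, w) \<in> Restr E K" by (auto simp: K_def intro: rtrancl_into_rtrancl)
    with step.IH show ?case by (rule rtrancl_into_rtrancl)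
  qed simp
  moreover have "K \<subseteq> V - ?gB" using KV \<open>K \<inter> ?gB = {}\<close> by blast
  ultimately have xz: "(x, z) \<in> off ?gB" by (rule Restr_walk_mono[rotated])
  obtain b where b: "b \<in> ?B" "(b, z) \<in> E" using z(1) by (auto simp: bd_def)
  have "(v, b) \<in> off ?gB"
    using nball_induced_connected nball_V[OF base] assms(2) b(1)
    by (intro induced_connected_off[of ?B]) auto
  moreover have "z \<in> K" using z(2) Restr_rtrancl_sym by (simp add: K_def)
  then have "(b, z) \<in> Restr E (V - ?gB)"
    using b edge_V[OF b(2)] assms(2) \<open>K \<inter> ?gB = {}\<close> by auto
  ultimately have "(v, z) \<in> off ?gB" by (rule rtrancl_into_rtrancl)
  then show ?thesis using Restr_rtrancl_sym[OF xz] by (rule rtrancl_trans)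
qed

text \<open>Let a ball \<open>B\<close> separate all ends, and let \<open>g ` B\<close> be disjoint from \<open>B\<close>.  At most one ray of \<open>R\<close> is
  bad: its tail lies in the component of \<open>G - B\<close> that contains \<open>g ` B\<close>.  If there were three ends, two
  rays \<open>r\<close> and \<open>s\<close> would not be bad, so their tails would be joined in \<open>G - g ` B\<close> via the base point.
  But \<open>g ` B\<close> separates all ends as well.\<close>
lemma card_end_representatives_le:
  assumes "finite R" "R \<subseteq> rays V E" "\<And>r s. r \<in> R \<Longrightarrow> s \<in> R \<Longrightarrow> r \<noteq> s \<Longrightarrow> (r, s) \<notin> end_rel V E"
    and complete: "\<And>r. r \<in> rays V E \<Longrightarrow> \<exists>s\<in>R. (r, s) \<in> end_rel V E"
  shows "card R \<le> 2"
proof (rule ccontr)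
  assume "\<not> card R \<le> 2"
  then have card: "card R \<ge> 3" by simp
  obtain n where n: "\<And>r s m i j. r \<in> R \<Longrightarrow> s \<in> R \<Longrightarrow> r \<noteq> s \<Longrightarrow> n \<le> m \<Longrightarrow>
     tail_avoids r i (nball v m) \<Longrightarrow> tail_avoids s j (nball v m) \<Longrightarrow> (r i, s j) \<notin> off (nball v m)"
    using inequivalent_ray_set_separated[OF assms(1-3) base] by blast
  note sep = n[OF _ _ _ order_refl]
  let ?B = "nball v n"
  obtain g where g: "g \<in> auts" "g ` ?B \<inter> ?B = {}"
    using displacement[of ?B ?B] nball_V[OF base] by auto
  let ?gB = "g ` ?B"
  have "\<exists>i. tail_avoids r i (?B \<union> ?gB)" if "r \<in> R" for r
  proof -
    have "r \<in> rays V E" "finite (?B \<union> ?gB)" using that assms(2) by auto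
    then obtain i where "tail_avoids r i (?B \<union> ?gB)" by (rule ray_tail_avoids)
    then show ?thesis ..
  qed
  then obtain i where i: "\<And>r. r \<in> R \<Longrightarrow> tail_avoids r (i r) (?B \<union> ?gB)" by metis
  have iB: "tail_avoids r (i r) ?B" and igB: "tail_avoids r (i r) ?gB" if "r \<in> R" for r
    using i[OF that] by (auto simp: tail_avoids_def)
  define bad where "bad = {r \<in> R. (g v, r (i r)) \<in> off ?B}"
  have fin: "finite bad" "finite (R - bad)" using assms(1) by (auto simp: bad_def)
  have "r = s" if "r \<in> bad" "s \<in> bad" for r s
  proof (rule ccontr)
    assume "r \<noteq> s"
    have "(g v, r (i r)) \<in> off ?B" "(g v, s (i s)) \<in> off ?B" using that by (simp_all add: bad_def)
    then have "(r (i r), s (i s)) \<in> off ?B" by (rule off_common)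
    moreover have "r \<in> R" "s \<in> R" using that by (simp_all add: bad_def)
    ultimately show False using sep[OF _ _ \<open>r \<noteq> s\<close> iB iB] by blast
  qed
  then have "card bad \<le> Suc 0" using card_le_Suc0_iff_eq[OF fin(1)] by blast
  moreover have "card (R - bad) = card R - card bad"
    using assms(1) by (intro card_Diff_subset) (auto simp: bad_def)
  ultimately have "\<not> card (R - bad) \<le> Suc 0" using card by linarith
  then obtain r s where rs: "r \<in> R - bad" "s \<in> R - bad" "r \<noteq> s"
    using card_le_Suc0_iff_eq[OF fin(2)] by blast
  then have R: "r \<in> R" "s \<in> R" "r \<in> rays V E" "s \<in> rays V E" using assms(2) by auto
  have v: "(v, q (i q)) \<in> off ?gB" if "q \<in> R - bad" for q
  proof (rule walk_around_moved_ball[OF g])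
    show "q (i q) \<in> V - ?B" using iB[of q] rayD(1)[of q "i q"] that assms(2) by (auto simp: tail_avoids_def)
    show "(g v, q (i q)) \<notin> off ?B" using that by (auto simp: bad_def)
  qed
  have rs_off: "(r (i r), s (i s)) \<in> off ?gB"
    by (rule rtrancl_trans[OF Restr_rtrancl_sym[OF v[OF rs(1)]] v[OF rs(2)]])
  \<comment> \<open>Pull back to \<open>B\<close>: the images of \<open>r\<close> and \<open>s\<close> are equivalent to distinct members of \<open>R\<close>.\<close>
  define h where "h = inv g"
  have h: "h \<in> auts" using g aut_inv by (simp add: h_def)
  have hgB: "h ` ?gB = ?B" using g(1) by (simp add: h_def image_comp comp_def)
  obtain r' where r': "r' \<in> R" "(h \<circ> r, r') \<in> end_rel V E" using complete aut_ray[OF h R(3)] by blast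
  obtain s' where s': "s' \<in> R" "(h \<circ> s, s') \<in> end_rel V E" using complete aut_ray[OF h R(4)] by blast
  have BV: "?B \<subseteq> V" "finite ?B" using nball_V[OF base] by auto
  have h_avoids: "tail_avoids (h \<circ> q) (i q) ?B" if "q \<in> R" for q
    unfolding tail_avoids_def
  proof (intro allI impI notI)
    fix m assume m: "i q \<le> m" "(h \<circ> q) m \<in> ?B"
    then have "h (q m) \<in> h ` ?gB" unfolding hgB by simp
    then have "q m \<in> ?gB" by (simp only: inj_image_mem_iff[OF aut_inj[OF h]])
    then show False using igB[OF that] m(1) by (simp add: tail_avoids_def)
  qed
  have "r' \<noteq> s'"
  proof
    assume "r' = s'"
    then have "(h \<circ> r, h \<circ> s) \<in> end_rel V E" using r'(2) s'(2) end_rel_trans end_rel_sym by blast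
    then have "(g \<circ> (h \<circ> r), g \<circ> (h \<circ> s)) \<in> end_rel V E" by (rule aut_end_rel[OF g(1)])
    moreover have "g \<circ> (h \<circ> q) = q" for q :: "nat \<Rightarrow> 'a" using g(1) by (auto simp: h_def)
    ultimately show False using assms(3)[OF R(1,2) rs(3)] by simp
  qed
  obtain k where k: "tail_avoids r' k ?B" using ray_tail_avoids[of r' ?B] r'(1) assms(2) BV by blast
  obtain l where l: "tail_avoids s' l ?B" using ray_tail_avoids[of s' ?B] s'(1) assms(2) BV by blast
  have "((h \<circ> r) (i r), (h \<circ> s) (i s)) \<in> off ?B"
    using rs_off aut_walk_off[OF h, of "r (i r)" "s (i s)" ?gB] hgB by simp
  then have "((h \<circ> r) (i r), s' l) \<in> off ?B"
    using end_relD_off[OF s'(2) BV h_avoids[OF R(2)] l] by (rule rtrancl_trans)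
  with end_relD_off[OF r'(2) BV h_avoids[OF R(1)] k] have "(r' k, s' l) \<in> off ?B"
    by (rule off_common)
  then show False using sep[OF r'(1) s'(1) \<open>r' \<noteq> s'\<close> k l] by blast
qed

lemma card_ends: "card (graph_ends V E) = 2"
proof -
  note eq = equiv_end_rel[OF simple]
  define rep where "rep K = (SOME r. r \<in> K)" for K :: "(nat \<Rightarrow> 'a) set"
  have rep: "rep K \<in> K" if "K \<in> graph_ends V E" for K
    using in_quotient_imp_non_empty[OF eq] that
    unfolding rep_def graph_ends_def by (simp add: some_in_eq)
  have rep_ray: "rep K \<in> rays V E" if "K \<in> graph_ends V E" for K
    using in_quotient_imp_subset[OF eq] that rep unfolding graph_ends_def by blast
  have rep_eq: "K = K'"
    if "K \<in> graph_ends V E" "K' \<in> graph_ends V E" "(rep K, rep K') \<in> end_rel V E" for K K'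
    using quotient_eqI[OF eq] that rep unfolding graph_ends_def by blast
  have rep_inj: "inj_on rep A" if "A \<subseteq> graph_ends V E" for A
  proof (rule inj_onI)
    fix K K' assume "K \<in> A" "K' \<in> A" "rep K = rep K'"
    moreover from this have "(rep K, rep K') \<in> end_rel V E"
      using that rep_ray[of K] eq by (auto simp: equiv_def refl_on_def)
    ultimately show "K = K'" using that rep_eq by blast
  qed
  have card_le: "card A \<le> C" if "A \<subseteq> graph_ends V E" "finite A" for A
  proof -
    have "card (rep ` A) \<le> C"
      using that rep_ray rep_eq by (intro card_inequivalent_rays_le) blast+
    then show ?thesis using card_image[OF rep_inj[OF that(1)]] by simp
  qed
  have fin: "finite (graph_ends V E)"
  proof (rule ccontr)
    assume "infinite (graph_ends V E)"
    then obtain A where "A \<subseteq> graph_ends V E" "finite A" "card A = Suc C"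
      using infinite_arbitrarily_large by blast
    then show False using card_le[of A] by simp
  qed
  have complete: "\<exists>s\<in>rep ` graph_ends V E. (r, s) \<in> end_rel V E" if "r \<in> rays V E" for r
  proof -
    have K: "end_rel V E `` {r} \<in> graph_ends V E"
      unfolding graph_ends_def using that by (rule quotientI)
    then have "(r, rep (end_rel V E `` {r})) \<in> end_rel V E" using rep by blast
    then show ?thesis using K by blast
  qed
  have "card (rep ` graph_ends V E) \<le> 2"
    using fin rep_ray rep_eq complete by (intro card_end_representatives_le) blast+
  then have "card (graph_ends V E) \<le> 2" using card_image[OF rep_inj[OF order_refl]] by simp
  moreover obtain r s where rs: "r \<in> rays V E" "s \<in> rays V E" "(r, s) \<notin> end_rel V E"
    using not_one_ended_rays[OF not_one_ended] by blast
  have "end_rel V E `` {r} \<noteq> end_rel V E `` {s}"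
    using eq_equiv_class[OF _ eq rs(2)] rs(3) by blast
  then have "card {end_rel V E `` {r}, end_rel V E `` {s}} = 2" by simp
  moreover have "{end_rel V E `` {r}, end_rel V E `` {s}} \<subseteq> graph_ends V E"
    unfolding graph_ends_def using rs by (auto intro: quotientI)
  then have "card {end_rel V E `` {r}, end_rel V E `` {s}} \<le> card (graph_ends V E)"
    using fin by (intro card_mono)
  ultimately show ?thesis by linarith
qed

end

theorem theorem4p5:
  fixes V :: "'a set" and E :: "('a \<times> 'a) set"
  assumes "simple_graph V E"
    and "locally_finite V E"
    and "connected_graph V E"
    and "linear_growth V E"
    and "countable (carrier (aut_group V E))"
    and "infinite (carrier (aut_group V E))"
  shows "card (graph_ends V E) = 2"
proof -
  interpret lf_graph V E using assms by unfold_locales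
  obtain v where v: "v \<in> V" using assms(3) by (auto simp: connected_graph_def)
  have inf: "infinite auts"
    using assms(6) finite_imageD[OF _ auts_eq_aut_group(2)] unfolding auts_eq_aut_group(1) by blast
  have "countable auts" unfolding auts_eq_aut_group(1) using assms(5) by (rule countable_image)
  then obtain \<rho> where \<rho>: "\<And>\<sigma>. \<sigma> \<in> auts \<Longrightarrow> (\<And>x. x \<in> nball v \<rho> \<Longrightarrow> \<sigma> x = x) \<Longrightarrow> \<sigma> = id"
    using countable_auts_imp_rigid[OF _ v] by blast
  obtain C where C: "\<And>N. \<exists>n\<ge>N. card (bd (nball v n)) \<le> C"
    using linear_growth_small_spheres[OF assms(4) v] by blast
  interpret thin_graph V E v \<rho> C
  proof unfold_locales
    show "v \<in> V" "infinite auts" by (fact v inf)+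
    show "\<sigma> = id" if "\<sigma> \<in> auts" "\<And>x. x \<in> nball v \<rho> \<Longrightarrow> \<sigma> x = x" for \<sigma>
      using that by (rule \<rho>)
    show "\<exists>n\<ge>N. card (bd (nball v n)) \<le> C" for N by (rule C)
  qed
  show ?thesis by (rule card_ends)
qed

end
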